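(* For any positive integer $d$, the diameter of the $d$-dimensional cyclohedron is at most $\lceil 5d/2\rceil-2$.
   Context: The diameter of a polytope is the diameter of its graph (vertices and edges of the polytope). The graph of the $d$-dimensional cyclohedron is described combinatorially (Simion) as follows, and this description may be taken as the definition. Let $\pi$ be a convex polygon with $2d+2$ vertices. An edge on $\pi$ is a set of two distinct vertices of $\pi$. For a vertex $x$, $\bar{x}$ denotes the opposite vertex (separated from $x$ by exactly $d$ vertices along the boundary on either side). A triangulation of $\pi$ is a maximal set of pairwise non-crossing edges on $\pi$; it contains all boundary edges, and its other edges are its interior edges. A triangulation $T$ is centrally symmetric when $\{x,y\}\in T$ implies $\{\bar{x},\bar{y}\}\in T$. The vertices of the graph are the centrally symmetric triangulations of $\pi$, and two of them are adjacent when they are related by a flip: given an interior edge $\{x,x'\}$ of $T$, let $y,y'$ be the other two vertices of the unique quadrilateral whose four boundary edges belong to $T$ and that has $\{x,x'\}$ as one of its diagonals; flipping $\{x,x'\}$ replaces $\{x,x'\}$ and $\{\bar{x},\bar{x}'\}$ by $\{y,y'\}$ and $\{\bar{y},\bar{y}'\}$. *)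

theory Defs
  imports Complex_Main "HOL-Library.Extended_Nat"
begin

text \<open>Distances are \<open>\<infinity>\<close> between vertices that are not joined by a walk, so a finite bound
  on the diameter includes connectedness.\<close>

definition graph_distance :: "'a rel \<Rightarrow> 'a \<Rightarrow> 'a \<Rightarrow> enat" where
  "graph_distance R u v = (INF n\<in>{n. (u, v) \<in> R ^^ n}. enat n)"

definition graph_diameter :: "'a set \<Rightarrow> 'a rel \<Rightarrow> enat" where
  "graph_diameter V R = (SUP u\<in>V. SUP v\<in>V. graph_distance R u v)"

text \<open>The vertices of the convex polygon with \<open>2 * d + 2\<close> vertices are numbered
  \<open>0, \<dots>, 2 * d + 1\<close> in their cyclic order along the boundary.\<close>

definition polygon_vertices :: "nat \<Rightarrow> nat set" where
  "polygon_vertices d = {..<2 * d + 2}"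

definition opposite :: "nat \<Rightarrow> nat \<Rightarrow> nat" where
  "opposite d x = (x + d + 1) mod (2 * d + 2)"

definition polygon_edges :: "nat \<Rightarrow> nat set set" where
  "polygon_edges d = {e. e \<subseteq> polygon_vertices d \<and> card e = 2}"

definition boundary_edges :: "nat \<Rightarrow> nat set set" where
  "boundary_edges d = {{x, (x + 1) mod (2 * d + 2)} | x. x \<in> polygon_vertices d}"

text \<open>By convexity, two edges cross (meet in their relative interiors without being equal) iff
  their endpoints are four distinct vertices that alternate along the boundary.\<close>

definition crossing :: "nat set \<Rightarrow> nat set \<Rightarrow> bool" where
  "crossing e f \<longleftrightarrow> (\<exists>a b a' b'. a < b \<and> b < a' \<and> a' < b' \<and>
     (e = {a, a'} \<and> f = {b, b'} \<or> e = {b, b'} \<and> f = {a, a'}))"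

definition noncrossing_edges :: "nat \<Rightarrow> nat set set \<Rightarrow> bool" where
  "noncrossing_edges d S \<longleftrightarrow> S \<subseteq> polygon_edges d \<and> (\<forall>e\<in>S. \<forall>f\<in>S. \<not> crossing e f)"

definition triangulation :: "nat \<Rightarrow> nat set set \<Rightarrow> bool" where
  "triangulation d T \<longleftrightarrow>
     noncrossing_edges d T \<and> (\<forall>S. noncrossing_edges d S \<and> T \<subseteq> S \<longrightarrow> S = T)"

definition centrally_symmetric :: "nat \<Rightarrow> nat set set \<Rightarrow> bool" where
  "centrally_symmetric d T \<longleftrightarrow> (\<forall>x y. {x, y} \<in> T \<longrightarrow> {opposite d x, opposite d y} \<in> T)"

definition cyclohedron_vertices :: "nat \<Rightarrow> nat set set set" where
  "cyclohedron_vertices d = {T. triangulation d T \<and> centrally_symmetric d T}"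

text \<open>The quadrilateral has vertices \<open>x, y, x', y'\<close> in this cyclic order: this is what the
  crossing of \<open>{x, x'}\<close> and \<open>{y, y'}\<close>, its diagonals, expresses. For a triangulation \<open>T\<close>, it is
  determined by \<open>{x, x'}\<close>. If \<open>x' = opposite d x\<close>, a single edge is replaced by a single edge.\<close>

definition flip :: "nat \<Rightarrow> nat set set \<Rightarrow> nat set set \<Rightarrow> bool" where
  "flip d T T' \<longleftrightarrow> (\<exists>x x' y y'.
     {x, x'} \<in> T - boundary_edges d \<and>
     crossing {x, x'} {y, y'} \<and>
     {x, y} \<in> T \<and> {y, x'} \<in> T \<and> {x', y'} \<in> T \<and> {y', x} \<in> T \<and>
     T' = (T - {{x, x'}, {opposite d x, opposite d x'}})
            \<union> {{y, y'}, {opposite d y, opposite d y'}})"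

text \<open>Flips between centrally symmetric triangulations are reversible; the disjunction only makes
  it manifest that the graph is undirected.\<close>

definition cyclohedron_adjacency :: "nat \<Rightarrow> nat set set rel" where
  "cyclohedron_adjacency d =
     {(T, T'). T \<in> cyclohedron_vertices d \<and> T' \<in> cyclohedron_vertices d \<and>
               (flip d T T' \<or> flip d T' T)}"

definition cyclohedron_diameter :: "nat \<Rightarrow> enat" where
  "cyclohedron_diameter d = graph_diameter (cyclohedron_vertices d) (cyclohedron_adjacency d)"

end

theory Submission
  imports Defs
begin

text \<open>
  Let \<open>n = d + 1\<close>, and call a triangulation a fan at \<open>x\<close> if, up to symmetry, all its \<open>d\<close> interior edges
  are incident to \<open>x\<close>. There are \<open>d\<close> fans at \<open>x\<close>. They are indexed by the apex of the triangle on the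
  diameter at \<open>x\<close>, and moving this apex by one step along the boundary is a flip. From a triangulation
  \<open>T\<close> with diameter \<open>{c, c + n}\<close> in which \<open>x\<close> has \<open>deg x\<close> interior edges, one reaches a fan at \<open>x\<close> by
  \<open>d - deg x\<close> flips, each of which adds an edge at \<open>x\<close>. Its apex is \<open>c\<close> (or \<open>c + n\<close>) if \<open>x\<close> is not an
  endpoint of the diameter, and otherwise it is the apex of the triangle of \<open>T\<close> on the diameter.

  Let \<open>p\<close> be the cyclic distance modulo \<open>n\<close> between the diameters of \<open>T\<close> and \<open>T'\<close>, so that
  \<open>p \<le> h\<close> for \<open>h = \<lceil>d / 2\<rceil>\<close>. If \<open>p = h\<close>, use the fans at an endpoint \<open>x\<close> of the diameter of \<open>T\<close>:
  the degree of \<open>x\<close> is at least 2 (if \<open>d \<ge> 2\<close>) and the apices are at distance at most \<open>h\<close>. If \<open>p < h\<close>,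
  two consecutive vertices lie outside the short arc between the diameters. At least one of them has
  an interior edge in \<open>T\<close>, and its fans have apices at distance \<open>p \<le> h - 1\<close>. Both cases give at most
  \<open>2 * d + h - 2\<close> flips.
\<close>

section \<open>Crossings and rotations\<close>

text \<open>The modulus \<open>2 * d + 2\<close> has to keep its shape, so that the facts about
  rotations apply to it.\<close>

declare add_2_eq_Suc [simp del] add_2_eq_Suc' [simp del]

text \<open>Each edge can be written in two orders and either one may contain the smallest vertex,
  which gives eight disjuncts. With the quantifiers gone, linear arithmetic can decide
  crossings.\<close>

lemma crossing_doubleton:
  "crossing {u, v} {s, t} \<longleftrightarrow>
     (u < s \<and> s < v \<and> v < t) \<or> (u < t \<and> t < v \<and> v < s) \<or>
     (v < s \<and> s < u \<and> u < t) \<or> (v < t \<and> t < u \<and> u < s) \<or>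
     (s < u \<and> u < t \<and> t < v) \<or> (t < u \<and> u < s \<and> s < v) \<or>
     (s < v \<and> v < t \<and> t < u) \<or> (t < v \<and> v < s \<and> s < u)"
  (is "?L \<longleftrightarrow> ?R")
proof
  assume ?L
  then show ?R
    unfolding crossing_def doubleton_eq_iff by (elim exE conjE disjE) simp_all
next
  have "crossing {p, r} {q, w} \<and> crossing {q, w} {p, r}" if "p < q" "q < r" "r < w"
    for p q r w :: nat
    using that unfolding crossing_def by blast
  then have "crossing {p, r} {q, w} \<and> crossing {q, w} {p, r} \<and> crossing {r, p} {q, w} \<and>
      crossing {q, w} {r, p} \<and> crossing {p, r} {w, q} \<and> crossing {w, q} {p, r} \<and>
      crossing {r, p} {w, q} \<and> crossing {w, q} {r, p}" if "p < q" "q < r" "r < w"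
    for p q r w :: nat
    using that by (simp add: insert_commute)
  moreover assume ?R
  ultimately show ?L
    by (elim disjE) simp_all
qed

lemma crossing_sym: "crossing e f \<Longrightarrow> crossing f e"
  unfolding crossing_def by blast

lemma polygon_edge_cases:
  assumes "e \<in> polygon_edges d"
  obtains u v where "e = {u, v}" "u < v" "v < 2 * d + 2"
proof -
  obtain x y where "e = {x, y}" "x \<noteq> y" "e \<subseteq> {..<2 * d + 2}"
    using assms by (auto simp: polygon_edges_def polygon_vertices_def card_2_iff)
  then show ?thesis
    by (cases "x < y") (auto intro: that[of x y] that[of y x] simp: insert_commute)
qed

lemma doubleton_in_polygon_edges:
  "{u, v} \<in> polygon_edges d \<longleftrightarrow> u < 2 * d + 2 \<and> v < 2 * d + 2 \<and> u \<noteq> v"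
  by (auto simp: polygon_edges_def polygon_vertices_def card_insert_if)

text \<open>Maximality need only be tested on single edges: an edge never crosses itself, so adding
  one that crosses nothing in \<open>T\<close> keeps the set non-crossing.\<close>

lemma triangulation_iff:
  "triangulation d T \<longleftrightarrow> noncrossing_edges d T \<and>
     (\<forall>g\<in>polygon_edges d. (\<forall>h\<in>T. \<not> crossing g h) \<longrightarrow> g \<in> T)" (is "?L \<longleftrightarrow> ?R")
proof
  assume L: ?L
  have "g \<in> T" if "g \<in> polygon_edges d" "\<forall>h\<in>T. \<not> crossing g h" for g
  proof -
    have "\<not> crossing g g"
      using that(1) by (auto elim!: polygon_edge_cases simp: crossing_doubleton)
    then have "noncrossing_edges d (insert g T)"
      using L that crossing_sym by (auto simp: triangulation_def noncrossing_edges_def)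
    then show ?thesis
      using L unfolding triangulation_def by blast
  qed
  then show ?R
    using L by (auto simp: triangulation_def)
next
  assume ?R
  then show ?L
    unfolding triangulation_def noncrossing_edges_def by blast
qed

section \<open>Rotations of the polygon as symmetries of the flip graph\<close>

definition rotate_vertex :: "nat \<Rightarrow> nat \<Rightarrow> nat \<Rightarrow> nat" where
  "rotate_vertex d r x = (x + r) mod (2 * d + 2)"

abbreviation rotate_edges :: "nat \<Rightarrow> nat \<Rightarrow> nat set set \<Rightarrow> nat set set" where
  "rotate_edges d r \<equiv> image (image (rotate_vertex d r))"

text \<open>Central symmetry is half a turn, so every fact about rotations also serves for
  \<open>opposite\<close>.\<close>

lemma opposite_eq_rotate: "opposite d = rotate_vertex d (d + 1)"
  by (auto simp: opposite_def rotate_vertex_def add.assoc)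

lemma rotate_vertex_less: "rotate_vertex d r x < 2 * d + 2"
  by (simp add: rotate_vertex_def)

lemma rotate_vertex_if:
  assumes "x < 2 * d + 2" "r < 2 * d + 2"
  shows "rotate_vertex d r x = (if x + r < 2 * d + 2 then x + r else x + r - (2 * d + 2))"
  using assms by (auto simp: rotate_vertex_def mod_if)

lemma rotate_vertex_add: "rotate_vertex d s (rotate_vertex d r x) = rotate_vertex d (r + s) x"
  by (simp add: rotate_vertex_def mod_add_left_eq add.assoc)

lemma rotate_vertex_mod: "rotate_vertex d (r mod (2 * d + 2)) = rotate_vertex d r"
  by (auto simp: rotate_vertex_def mod_add_right_eq)

lemma rotate_vertex_full: "x < 2 * d + 2 \<Longrightarrow> rotate_vertex d (2 * d + 2) x = x"
  unfolding rotate_vertex_def by (metis mod_add_self2 mod_less)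

text \<open>The bound \<open>r \<le> 2 * d + 2\<close> is non-strict so that it is inherited by the
  inverse amount \<open>2 * d + 2 - r\<close>, also for \<open>r = 0\<close>.\<close>

lemma rotate_vertex_inverse:
  assumes "r \<le> 2 * d + 2" "x < 2 * d + 2"
  shows "rotate_vertex d (2 * d + 2 - r) (rotate_vertex d r x) = x"
    and "rotate_vertex d r (rotate_vertex d (2 * d + 2 - r) x) = x"
  using assms by (simp_all only: rotate_vertex_add le_add_diff_inverse le_add_diff_inverse2
      rotate_vertex_full)

lemma rotate_vertex_inj:
  assumes "r \<le> 2 * d + 2"
  shows "inj_on (rotate_vertex d r) (polygon_vertices d)"
  by (rule inj_on_inverseI[of _ "rotate_vertex d (2 * d + 2 - r)"])
    (use assms in \<open>simp add: rotate_vertex_inverse polygon_vertices_def\<close>)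

lemma rotate_edge_in_polygon_edges:
  assumes "r \<le> 2 * d + 2" "e \<in> polygon_edges d"
  shows "rotate_vertex d r ` e \<in> polygon_edges d"
  using assms rotate_vertex_less card_image[OF inj_on_subset[OF rotate_vertex_inj]]
  by (fastforce simp: polygon_edges_def polygon_vertices_def)

lemma rotate_edge_inverse:
  assumes "r \<le> 2 * d + 2" "e \<subseteq> polygon_vertices d"
  shows "rotate_vertex d (2 * d + 2 - r) ` rotate_vertex d r ` e = e"
    and "rotate_vertex d r ` rotate_vertex d (2 * d + 2 - r) ` e = e"
proof -
  have "x < 2 * d + 2" if "x \<in> e" for x
    using that assms(2) by (auto simp: polygon_vertices_def)
  then show "rotate_vertex d (2 * d + 2 - r) ` rotate_vertex d r ` e = e"
    "rotate_vertex d r ` rotate_vertex d (2 * d + 2 - r) ` e = e"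
    using assms(1) by (simp_all add: image_image rotate_vertex_inverse)
qed

lemma crossing_rotate_less:
  assumes "r < 2 * d + 2" "a < b" "b < a'" "a' < b'" "b' < 2 * d + 2"
  shows "crossing {rotate_vertex d r a, rotate_vertex d r a'}
    {rotate_vertex d r b, rotate_vertex d r b'}"
proof -
  let ?r = "rotate_vertex d r"
  \<comment> \<open>The cases say that none, one, two, three or all of the four vertices wrap past
    \<open>2 * d + 1\<close>. Each time their order is shifted cyclically, which preserves
    alternation.\<close>
  consider "b' + r < 2 * d + 2" | "a' + r < 2 * d + 2" "2 * d + 2 \<le> b' + r"
    | "b + r < 2 * d + 2" "2 * d + 2 \<le> a' + r" | "a + r < 2 * d + 2" "2 * d + 2 \<le> b + r"
    | "2 * d + 2 \<le> a + r"
    by linarith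
  then show ?thesis
  proof cases
    case 1
    then have "?r a < ?r b" "?r b < ?r a'" "?r a' < ?r b'"
      using assms by (simp_all add: rotate_vertex_if)
    then show ?thesis
      by (simp add: crossing_doubleton)
  next
    case 2
    then have "?r b' < ?r a" "?r a < ?r b" "?r b < ?r a'"
      using assms by (simp_all add: rotate_vertex_if)
    then show ?thesis
      by (simp add: crossing_doubleton)
  next
    case 3
    then have "?r a' < ?r b'" "?r b' < ?r a" "?r a < ?r b"
      using assms by (simp_all add: rotate_vertex_if)
    then show ?thesis
      by (simp add: crossing_doubleton)
  next
    case 4
    then have "?r b < ?r a'" "?r a' < ?r b'" "?r b' < ?r a"
      using assms by (simp_all add: rotate_vertex_if)
    then show ?thesis
      by (simp add: crossing_doubleton)
  next
    case 5
    then have "?r a < ?r b" "?r b < ?r a'" "?r a' < ?r b'"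
      using assms by (simp_all add: rotate_vertex_if)
    then show ?thesis
      by (simp add: crossing_doubleton)
  qed
qed

lemma crossing_rotate:
  assumes "r \<le> 2 * d + 2" "e \<in> polygon_edges d" "f \<in> polygon_edges d" "crossing e f"
  shows "crossing (rotate_vertex d r ` e) (rotate_vertex d r ` f)"
proof -
  have *: "crossing {rotate_vertex d r a, rotate_vertex d r a'}
    {rotate_vertex d r b, rotate_vertex d r b'}"
    if "a < b" "b < a'" "a' < b'" "b' < 2 * d + 2" for a a' b b'
    using crossing_rotate_less[of "r mod (2 * d + 2)", OF _ that] by (simp add: rotate_vertex_mod)
  obtain a b a' b' where ab: "a < b" "b < a'" "a' < b'"
    and ef: "e = {a, a'} \<and> f = {b, b'} \<or> e = {b, b'} \<and> f = {a, a'}"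
    using assms(4) unfolding crossing_def by blast
  have "b' < 2 * d + 2"
    using ef assms(2,3) by (auto simp: polygon_edges_def polygon_vertices_def)
  from *[OF ab this] show ?thesis
    using ef crossing_sym by auto
qed

lemma crossing_rotate_iff:
  assumes "r \<le> 2 * d + 2" "e \<in> polygon_edges d" "f \<in> polygon_edges d"
  shows "crossing (rotate_vertex d r ` e) (rotate_vertex d r ` f) \<longleftrightarrow> crossing e f"
proof
  assume "crossing (rotate_vertex d r ` e) (rotate_vertex d r ` f)"
  from crossing_rotate[OF _ _ _ this, of "2 * d + 2 - r" d] show "crossing e f"
    using assms rotate_edge_in_polygon_edges rotate_edge_inverse
    by (simp add: polygon_edges_def)
qed (use assms crossing_rotate in blast)

lemma rotate_triangulation:
  assumes "r \<le> 2 * d + 2" "triangulation d T"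
  shows "triangulation d (rotate_edges d r T)"
  unfolding triangulation_iff
proof (intro conjI ballI impI)
  have T: "T \<subseteq> polygon_edges d" and nc: "\<And>e f. e \<in> T \<Longrightarrow> f \<in> T \<Longrightarrow> \<not> crossing e f"
    using assms(2) by (auto simp: triangulation_def noncrossing_edges_def)
  have max: "g \<in> T" if "g \<in> polygon_edges d" "\<forall>h\<in>T. \<not> crossing g h" for g
    using assms(2) that by (simp add: triangulation_iff)
  show "noncrossing_edges d (rotate_edges d r T)"
    unfolding noncrossing_edges_def
    using T nc assms(1) by (auto simp: crossing_rotate_iff rotate_edge_in_polygon_edges subset_iff)
  \<comment> \<open>Maximality is transferred by pulling \<open>g\<close> back with the inverse
    rotation and using the maximality of \<open>T\<close>.\<close>
  fix g assume g: "g \<in> polygon_edges d" "\<forall>h\<in>rotate_edges d r T. \<not> crossing g h"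
  let ?g = "rotate_vertex d (2 * d + 2 - r) ` g"
  have g': "?g \<in> polygon_edges d" "rotate_vertex d r ` ?g = g"
    using g(1) assms(1) rotate_edge_in_polygon_edges[of "2 * d + 2 - r"] rotate_edge_inverse(2)
    by (auto simp: polygon_edges_def)
  have "\<not> crossing ?g h" if "h \<in> T" for h
    using crossing_rotate[of r d ?g h] that T g(2) g' assms(1) by auto
  then have "?g \<in> T"
    using max g'(1) by blast
  then show "g \<in> rotate_edges d r T"
    using g'(2) by blast
qed

lemma centrally_symmetric_iff:
  assumes "T \<subseteq> polygon_edges d"
  shows "centrally_symmetric d T \<longleftrightarrow> (\<forall>e\<in>T. opposite d ` e \<in> T)"
  using assms unfolding centrally_symmetric_def
  by (metis (no_types, lifting) image_empty image_insert polygon_edge_cases subset_iff)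

lemma opposite_rotate: "opposite d (rotate_vertex d r x) = rotate_vertex d r (opposite d x)"
  by (simp add: opposite_eq_rotate rotate_vertex_add add.commute)

lemma cyclohedron_vertices_subset:
  "T \<in> cyclohedron_vertices d \<Longrightarrow> T \<subseteq> polygon_edges d"
  by (auto simp: cyclohedron_vertices_def triangulation_def noncrossing_edges_def)

lemma rotate_cyclohedron_vertices:
  assumes "r \<le> 2 * d + 2" "T \<in> cyclohedron_vertices d"
  shows "rotate_edges d r T \<in> cyclohedron_vertices d"
proof -
  have *: "triangulation d (rotate_edges d r T)"
    using assms rotate_triangulation by (auto simp: cyclohedron_vertices_def)
  then have "rotate_edges d r T \<subseteq> polygon_edges d"
    by (auto simp: triangulation_def noncrossing_edges_def)
  moreover have "opposite d ` rotate_vertex d r ` e \<in> rotate_edges d r T" if "e \<in> T" for e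
  proof -
    have "opposite d ` e \<in> T"
      using that assms(2) cyclohedron_vertices_subset[OF assms(2)]
      by (auto simp: cyclohedron_vertices_def centrally_symmetric_iff)
    then show ?thesis
      by (auto simp: image_image opposite_rotate intro!: image_eqI[of _ _ "opposite d ` e"])
  qed
  ultimately show ?thesis
    using * by (auto simp: cyclohedron_vertices_def centrally_symmetric_iff)
qed

lemma rotate_boundary_edges:
  assumes "r \<le> 2 * d + 2" "e \<in> boundary_edges d"
  shows "rotate_vertex d r ` e \<in> boundary_edges d"
proof -
  obtain x where x: "e = {x, rotate_vertex d 1 x}"
    using assms(2) by (auto simp: boundary_edges_def rotate_vertex_def)
  have "rotate_vertex d r ` e = {rotate_vertex d r x, rotate_vertex d 1 (rotate_vertex d r x)}"
    unfolding x by (simp add: rotate_vertex_add add.commute)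
  then show ?thesis
    using rotate_vertex_less[of d r x]
    by (auto simp: boundary_edges_def polygon_vertices_def rotate_vertex_def[of d "Suc 0"])
qed

lemma rotate_edges_inverse:
  assumes "r \<le> 2 * d + 2" "T \<subseteq> polygon_edges d"
  shows "rotate_edges d (2 * d + 2 - r) (rotate_edges d r T) = T"
proof -
  have "(\<lambda>e. rotate_vertex d (2 * d + 2 - r) ` rotate_vertex d r ` e) ` T = (\<lambda>e. e) ` T"
  proof (rule image_cong)
    fix e assume "e \<in> T"
    then show "rotate_vertex d (2 * d + 2 - r) ` rotate_vertex d r ` e = e"
      using assms by (intro rotate_edge_inverse) (auto simp: polygon_edges_def)
  qed simp
  then show ?thesis
    by (simp add: image_image)
qed

text \<open>Rotations commute with \<open>opposite\<close>, preserve crossings and boundary edges,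
  and are injective on polygon edges, so that images commute with the removal of the flipped
  edges.\<close>

lemma rotate_flip:
  assumes r: "r \<le> 2 * d + 2" and T: "T \<subseteq> polygon_edges d"
    and "flip d T T'"
  shows "flip d (rotate_edges d r T) (rotate_edges d r T')"
proof -
  let ?r = "rotate_vertex d r" and ?o = "opposite d"
  obtain x x' y y' where xy: "{x, x'} \<in> T" "{x, x'} \<notin> boundary_edges d"
    "crossing {x, x'} {y, y'}" "{x, y} \<in> T" "{y, x'} \<in> T" "{x', y'} \<in> T" "{y', x} \<in> T"
    "T' = (T - {{x, x'}, {?o x, ?o x'}}) \<union> {{y, y'}, {?o y, ?o y'}}"
    using assms(3) unfolding flip_def by blast
  have inj: "inj_on (image ?r) (polygon_edges d)"
    by (rule inj_on_inverseI, rule rotate_edge_inverse(1)[OF r]) (simp add: polygon_edges_def)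
  have v: "x < 2 * d + 2" "x' < 2 * d + 2" "y < 2 * d + 2" "y' < 2 * d + 2" "x \<noteq> x'"
    using xy(1,5-7)[THEN subsetD[OF T]] by (simp_all add: doubleton_in_polygon_edges)
  have yy: "{y, y'} \<in> polygon_edges d"
    using xy(3) v by (auto simp: doubleton_in_polygon_edges crossing_doubleton)
  have o: "{?o x, ?o x'} \<in> polygon_edges d"
    using rotate_edge_in_polygon_edges[of "d + 1" d "{x, x'}"] v
    by (simp add: opposite_eq_rotate doubleton_in_polygon_edges)
  have "rotate_edges d r (T - {{x, x'}, {?o x, ?o x'}}) =
      rotate_edges d r T - rotate_edges d r {{x, x'}, {?o x, ?o x'}}"
    by (rule inj_on_image_set_diff[OF inj]) (use T o xy(1) in auto)
  then have "rotate_edges d r T' = (rotate_edges d r T - {{?r x, ?r x'}, {?o (?r x), ?o (?r x')}})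
      \<union> {{?r y, ?r y'}, {?o (?r y), ?o (?r y')}}"
    by (simp only: xy(8) image_Un image_insert image_empty opposite_rotate)
  moreover have "{?r x, ?r x'} \<notin> boundary_edges d"
  proof
    assume "{?r x, ?r x'} \<in> boundary_edges d"
    then have "rotate_vertex d (2 * d + 2 - r) ` {?r x, ?r x'} \<in> boundary_edges d"
      by (intro rotate_boundary_edges) auto
    then show False
      using xy(2) v r by (simp add: rotate_vertex_inverse)
  qed
  moreover have "crossing {?r x, ?r x'} {?r y, ?r y'}"
    using crossing_rotate[OF r subsetD[OF T xy(1)] yy xy(3)] by simp
  moreover have im: "{?r u, ?r w} \<in> rotate_edges d r T" if "{u, w} \<in> T" for u w
    using imageI[OF that, of "image ?r"] by simp
  ultimately have "{?r x, ?r x'} \<in> rotate_edges d r T - boundary_edges d \<and>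
      crossing {?r x, ?r x'} {?r y, ?r y'} \<and> {?r x, ?r y} \<in> rotate_edges d r T \<and>
      {?r y, ?r x'} \<in> rotate_edges d r T \<and> {?r x', ?r y'} \<in> rotate_edges d r T \<and>
      {?r y', ?r x} \<in> rotate_edges d r T \<and>
      rotate_edges d r T' = (rotate_edges d r T - {{?r x, ?r x'}, {?o (?r x), ?o (?r x')}})
        \<union> {{?r y, ?r y'}, {?o (?r y), ?o (?r y')}}"
    using xy(1,4-7)[THEN im] by (intro conjI DiffI)
  then show ?thesis
    unfolding flip_def by (intro exI)
qed

lemma rotate_adjacency:
  assumes "r \<le> 2 * d + 2" "(T, T') \<in> cyclohedron_adjacency d"
  shows "(rotate_edges d r T, rotate_edges d r T') \<in> cyclohedron_adjacency d"
proof -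
  have T: "T \<in> cyclohedron_vertices d" "T' \<in> cyclohedron_vertices d"
    and flip: "flip d T T' \<or> flip d T' T"
    using assms(2) by (auto simp: cyclohedron_adjacency_def)
  note sub = T[THEN cyclohedron_vertices_subset]
  have "flip d (rotate_edges d r T) (rotate_edges d r T') \<or>
      flip d (rotate_edges d r T') (rotate_edges d r T)"
    using flip rotate_flip[OF assms(1) sub(1)] rotate_flip[OF assms(1) sub(2)] by (elim disjE) simp_all
  then show ?thesis
    using T[THEN rotate_cyclohedron_vertices[OF assms(1)]]
    by (simp add: cyclohedron_adjacency_def)
qed

lemma rotate_adjacency_pow:
  assumes "r \<le> 2 * d + 2" "(T, T') \<in> cyclohedron_adjacency d ^^ m"
  shows "(rotate_edges d r T, rotate_edges d r T') \<in> cyclohedron_adjacency d ^^ m"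
  using assms(2)
proof (induction m arbitrary: T')
  case (Suc m)
  then obtain U where "(T, U) \<in> cyclohedron_adjacency d ^^ m" "(U, T') \<in> cyclohedron_adjacency d"
    by auto
  then show ?case
    using Suc.IH[of U] rotate_adjacency[OF assms(1)] by (meson relpow_Suc_I)
qed simp

text \<open>Walks may thus be sought after rotating both triangulations so that the chosen fan
  vertex becomes \<open>0\<close>.\<close>

lemma rotate_adjacency_pow_iff:
  assumes "r \<le> 2 * d + 2" "T \<in> cyclohedron_vertices d" "T' \<in> cyclohedron_vertices d"
  shows "(rotate_edges d r T, rotate_edges d r T') \<in> cyclohedron_adjacency d ^^ m \<longleftrightarrow>
    (T, T') \<in> cyclohedron_adjacency d ^^ m" (is "?L \<longleftrightarrow> _")
proof
  assume ?L
  from rotate_adjacency_pow[OF _ this, of "2 * d + 2 - r"]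
  show "(T, T') \<in> cyclohedron_adjacency d ^^ m"
    using assms by (simp add: rotate_edges_inverse cyclohedron_vertices_subset)
qed (rule rotate_adjacency_pow[OF assms(1)])

lemma adjacency_pow_sym:
  "(T, T') \<in> cyclohedron_adjacency d ^^ m \<Longrightarrow> (T', T) \<in> cyclohedron_adjacency d ^^ m"
proof (induction m arbitrary: T')
  case (Suc m)
  then obtain U where "(T, U) \<in> cyclohedron_adjacency d ^^ m" "(U, T') \<in> cyclohedron_adjacency d"
    by auto
  then have "(U, T) \<in> cyclohedron_adjacency d ^^ m" "(T', U) \<in> cyclohedron_adjacency d"
    using Suc.IH by (auto simp: cyclohedron_adjacency_def)
  then show ?case
    by (meson relpow_Suc_I2)
qed simp

section \<open>Triangles and flips\<close>

lemma crossing_less: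
  assumes "u < v" "s < t"
  shows "crossing {u, v} {s, t} \<longleftrightarrow> (u < s \<and> s < v \<and> v < t) \<or> (s < u \<and> u < t \<and> t < v)"
  using assms unfolding crossing_doubleton by linarith

text \<open>An edge that crosses one diagonal of a quadrilateral enters its interior. If it crosses
  no side, it can leave only through corners, hence it is the other diagonal.\<close>

lemma crossing_imp_diagonal:
  assumes "p < a" "a < y" "y < b" "u < v"
    and "\<not> crossing {u, v} {p, a}" "\<not> crossing {u, v} {a, y}"
    and "\<not> crossing {u, v} {y, b}" "\<not> crossing {u, v} {p, b}"
  shows "crossing {u, v} {a, b} \<Longrightarrow> {u, v} = {p, y}"
    and "crossing {u, v} {p, y} \<Longrightarrow> {u, v} = {a, b}"
proof -
  have lt: "p < b" "a < b" "p < y"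
    using assms(1-3) by linarith+
  note sides = assms(5-8)[unfolded crossing_less[OF assms(4) assms(1)]
      crossing_less[OF assms(4) assms(2)] crossing_less[OF assms(4) assms(3)]
      crossing_less[OF assms(4) lt(1)]]
  show "{u, v} = {p, y}" if "crossing {u, v} {a, b}"
    using that[unfolded crossing_less[OF assms(4) lt(2)]]
  proof
    assume *: "u < a \<and> a < v \<and> v < b"
    then have "u = p" using sides(1,4) assms(1) by linarith
    moreover have "v = y" using * sides(2,3) assms(2) by linarith
    ultimately show ?thesis by simp
  next
    assume "a < u \<and> u < b \<and> b < v"
    then show ?thesis using sides(4) assms(1-4) by linarith
  qed
  show "{u, v} = {a, b}" if "crossing {u, v} {p, y}"
    using that[unfolded crossing_less[OF assms(4) lt(3)]]
  proof
    assume "u < p \<and> p < v \<and> v < y"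
    then show ?thesis using sides(4) assms(1-4) by linarith
  next
    assume *: "p < u \<and> u < y \<and> y < v"
    then have "u = a" using sides(1,2) assms(1,2) by linarith
    moreover have "v = b" using * sides(3,4) assms(3) by linarith
    ultimately show ?thesis by simp
  qed
qed

lemma opposite_if:
  assumes "x < 2 * d + 2"
  shows "opposite d x = (if x \<le> d then x + (d + 1) else x - (d + 1))"
  using rotate_vertex_if[of x d "d + 1"] assms unfolding opposite_eq_rotate by simp

lemma opposite_opposite: "x < 2 * d + 2 \<Longrightarrow> opposite d (opposite d x) = x"
  by (cases "x \<le> d") (simp_all add: opposite_if)

section \<open>Triangles and flips in one centrally symmetric triangulation\<close>

context
  fixes d :: nat and T :: "nat set set"
  assumes T: "T \<in> cyclohedron_vertices d"
begin

lemma edge_less: "{u, v} \<in> T \<Longrightarrow> u < 2 * d + 2 \<and> v < 2 * d + 2 \<and> u \<noteq> v"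
  using subsetD[OF cyclohedron_vertices_subset[OF T]] doubleton_in_polygon_edges by blast

lemma noncrossing: "e \<in> T \<Longrightarrow> f \<in> T \<Longrightarrow> \<not> crossing e f"
  using T by (auto simp: cyclohedron_vertices_def triangulation_def noncrossing_edges_def)

lemma edge_if_noncrossing:
  "g \<in> polygon_edges d \<Longrightarrow> (\<And>h. h \<in> T \<Longrightarrow> \<not> crossing g h) \<Longrightarrow> g \<in> T"
  using T by (auto simp: cyclohedron_vertices_def triangulation_iff)

lemma opposite_edge: "{u, v} \<in> T \<Longrightarrow> {opposite d u, opposite d v} \<in> T"
  using T by (auto simp: cyclohedron_vertices_def centrally_symmetric_def)

lemma opposite_image_edge: "e \<in> T \<Longrightarrow> opposite d ` e \<in> T"
  using T centrally_symmetric_iff[OF cyclohedron_vertices_subset[OF T]]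
  by (simp add: cyclohedron_vertices_def)

lemma edge_if_noncrossing_less:
  assumes "u < v" "v < 2 * d + 2"
    and "\<And>s t. {s, t} \<in> T \<Longrightarrow> s < t \<Longrightarrow> \<not> (u < s \<and> s < v \<and> v < t) \<and> \<not> (s < u \<and> u < t \<and> t < v)"
  shows "{u, v} \<in> T"
proof (rule edge_if_noncrossing)
  show "{u, v} \<in> polygon_edges d"
    using assms by (simp add: doubleton_in_polygon_edges)
  fix h assume h: "h \<in> T"
  obtain s t where st: "h = {s, t}" "s < t"
    using subsetD[OF cyclohedron_vertices_subset[OF T] h] by (rule polygon_edge_cases)
  show "\<not> crossing {u, v} h"
    using assms(3)[of s t] h assms(1) by (simp add: st crossing_less)
qed

lemma boundary_edge:
  "Suc u < 2 * d + 2 \<Longrightarrow> {u, Suc u} \<in> T"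
  "{0, 2 * d + 1} \<in> T"
proof -
  show "{u, Suc u} \<in> T" if "Suc u < 2 * d + 2"
    by (rule edge_if_noncrossing_less) (use that in linarith)+
  show "{0, 2 * d + 1} \<in> T"
    by (rule edge_if_noncrossing_less) (use edge_less in \<open>force+\<close>)
qed

text \<open>An edge crossing \<open>{a, b}\<close> without crossing \<open>{p, a}\<close> or
  \<open>{p, b}\<close> would have to join \<open>p\<close> to a vertex strictly between
  \<open>a\<close> and \<open>b\<close>.\<close>

lemma consecutive_neighbours_edge:
  assumes "p < a" "a < b" "{p, a} \<in> T" "{p, b} \<in> T"
    and "\<And>c. a < c \<Longrightarrow> c < b \<Longrightarrow> {p, c} \<notin> T"
  shows "{a, b} \<in> T"
proof (rule edge_if_noncrossing_less)
  fix s t assume st: "{s, t} \<in> T" "s < t"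
  have "p < b"
    using assms(1,2) by simp
  have "\<not> crossing {s, t} {p, a}" "\<not> crossing {s, t} {p, b}"
    using noncrossing st assms(3,4) by blast+
  note sides = this[unfolded crossing_less[OF st(2) assms(1)] crossing_less[OF st(2) \<open>p < b\<close>]]
  have "\<not> (s = p \<and> a < t \<and> t < b)"
    using assms(5) st by auto
  then show "\<not> (a < s \<and> s < b \<and> b < t) \<and> \<not> (s < a \<and> a < t \<and> t < b)"
    using assms(1,2) st(2) sides by (intro conjI notI) linarith+
qed (use assms edge_less in blast)+

text \<open>The apex is the largest neighbour of \<open>a\<close> below \<open>b\<close>; one exists
  because \<open>a + 1\<close> is a neighbour along the boundary.\<close>

lemma triangle_apex:
  assumes "a + 2 \<le> b" "{a, b} \<in> T"
  obtains y where "a < y" "y < b" "{a, y} \<in> T" "{y, b} \<in> T"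
proof -
  define Y where "Y = {y. a < y \<and> y < b \<and> {a, y} \<in> T}"
  have "finite Y"
    unfolding Y_def by (rule finite_subset[of _ "{..<b}"]) auto
  moreover have "Suc a \<in> Y"
    using boundary_edge(1)[of a] assms edge_less[of a b] by (auto simp: Y_def)
  ultimately have Y: "Max Y \<in> Y" "\<And>c. c \<in> Y \<Longrightarrow> c \<le> Max Y"
    using Max_in by auto
  have Y_iff: "c \<in> Y \<longleftrightarrow> a < c \<and> c < b \<and> {a, c} \<in> T" for c
    by (simp add: Y_def)
  have Y_max: "a < Max Y" "Max Y < b" "{a, Max Y} \<in> T"
    using Y(1) unfolding Y_iff by auto
  have "{Max Y, b} \<in> T"
  proof (rule consecutive_neighbours_edge[of a])
    fix c assume "Max Y < c" "c < b"
    then show "{a, c} \<notin> T"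
      using Y_max Y(2)[of c] unfolding Y_iff by linarith
  qed (use Y_max assms(2) in simp_all)
  then show ?thesis
    using that Y_max by blast
qed

text \<open>The vertices \<open>a\<close> and \<open>b\<close> are the neighbours of
  \<open>p\<close> closest to \<open>z\<close> on either side, and \<open>y\<close> is the apex of
  the triangle on \<open>{a, b}\<close> turned away from \<open>p\<close>. Flipping
  \<open>{a, b}\<close> then produces the missing edge \<open>{p, y}\<close>, where \<open>y\<close>
  may differ from \<open>z\<close>.\<close>

lemma surrounding_neighbours:
  assumes "p < l" "l < z" "z < u" "{p, l} \<in> T" "{p, u} \<in> T" "{p, z} \<notin> T"
  obtains a b y where "l \<le> a" "a < z" "z < b" "b \<le> u" "a < y" "y < b"
    "{p, a} \<in> T" "{p, b} \<in> T" "{a, b} \<in> T" "{a, y} \<in> T" "{y, b} \<in> T" "{p, y} \<notin> T"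
proof -
  define A where "A = {c. l \<le> c \<and> c < z \<and> {p, c} \<in> T}"
  define B where "B = {c. z < c \<and> c \<le> u \<and> {p, c} \<in> T}"
  have A_iff: "c \<in> A \<longleftrightarrow> l \<le> c \<and> c < z \<and> {p, c} \<in> T"
    and B_iff: "c \<in> B \<longleftrightarrow> z < c \<and> c \<le> u \<and> {p, c} \<in> T" for c
    by (simp_all add: A_def B_def)
  have fin: "finite A" "finite B"
    using assms(3) by (auto simp: A_def B_def intro!: finite_subset[of _ "{..u}"])
  have ne: "l \<in> A" "u \<in> B"
    using assms by (simp_all add: A_iff B_iff)
  have A: "Max A \<in> A" and B: "Min B \<in> B"
    using Max_in Min_in fin ne by blast+
  have bounds: "l \<le> Max A" "Max A < z" "{p, Max A} \<in> T" "z < Min B" "Min B \<le> u" "{p, Min B} \<in> T"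
    using A B unfolding A_iff B_iff by auto
  have gap: "{p, c} \<notin> T" if c: "Max A < c" "c < Min B" for c
  proof
    assume pc: "{p, c} \<in> T"
    have "c \<notin> A" "c \<notin> B"
      using c Max_ge[OF fin(1)] Min_le[OF fin(2)] leD by blast+
    then have "c = z"
      using pc c bounds unfolding A_iff B_iff by linarith
    then show False
      using pc assms(6) by simp
  qed
  have ab: "{Max A, Min B} \<in> T"
    by (rule consecutive_neighbours_edge[of p]) (use bounds assms(1) gap in auto)
  obtain y where y: "Max A < y" "y < Min B" "{Max A, y} \<in> T" "{y, Min B} \<in> T"
    using triangle_apex[OF _ ab] bounds by auto
  show ?thesis
    using that[OF bounds(1,2,4,5) y(1,2) bounds(3,6) ab y(3,4) gap[OF y(1,2)]] .
qed

text \<open>Take a shortest edge \<open>{a, b}\<close> with \<open>b - a \<ge> d + 1\<close>. If it were not a diameter, both other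
  sides of its triangle would be too short to avoid the opposite edge \<open>{b - (d + 1), a + (d + 1)}\<close>.\<close>

lemma diameter_edge:
  obtains k where "k \<le> d" "{k, k + (d + 1)} \<in> T"
proof -
  define P where "P = (\<lambda>l. \<exists>a b. {a, b} \<in> T \<and> b = a + l \<and> d + 1 \<le> l)"
  have "P (2 * d + 1)"
    using boundary_edge(2) by (auto simp: P_def intro!: exI[of _ 0])
  then have P: "P (LEAST l. P l)" and least: "\<And>l. P l \<Longrightarrow> (LEAST l. P l) \<le> l"
    by (auto intro: LeastI Least_le)
  obtain a b where ab: "{a, b} \<in> T" "b = a + (LEAST l. P l)" "d + 1 \<le> (LEAST l. P l)"
    using P unfolding P_def by blast
  have bd: "b < 2 * d + 2"
    using edge_less ab(1) by blast
  show ?thesis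
  proof (cases "b = a + (d + 1)")
    case True
    then show ?thesis
      using ab(1) bd that[of a] by auto
  next
    case False
    with ab have lt: "a + (d + 1) < b" by linarith
    obtain y where y: "a < y" "y < b" "{a, y} \<in> T" "{y, b} \<in> T"
      using triangle_apex[OF _ ab(1)] lt by auto
    have shorter: "v < u + (d + 1) \<or> (LEAST l. P l) \<le> v - u" if "{u, v} \<in> T" "u < v" for u v
    proof (cases "v < u + (d + 1)")
      case False
      then have "P (v - u)"
        unfolding P_def using that by (intro exI[of _ u] exI[of _ v]) auto
      then show ?thesis
        using least by blast
    qed simp
    have "y < a + (d + 1)" "b < y + (d + 1)"
      using shorter[of a y] shorter[of y b] ab(2) y by linarith+
    then have "crossing {a, y} {b - (d + 1), a + (d + 1)}"
      using lt y crossing_less[of a y "b - (d + 1)" "a + (d + 1)"] by linarith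
    moreover have "{a + (d + 1), b - (d + 1)} \<in> T"
      using opposite_edge[OF ab(1)] lt bd by (simp add: opposite_if)
    ultimately show ?thesis
      using noncrossing[OF y(3)] by (simp add: insert_commute)
  qed
qed

text \<open>Among the edges of \<open>T\<close>, only the old diagonal can cross the new one, and
  symmetrically for the opposites. Conversely, an edge crossing nothing in \<open>T'\<close> either
  crosses nothing in \<open>T\<close> or is one of the new edges. This gives both non-crossing and
  maximality of \<open>T'\<close>.\<close>

lemma flip_quadrilateral:
  assumes ord: "p < a" "a < y" "y < b"
    and sides: "{p, a} \<in> T" "{a, y} \<in> T" "{y, b} \<in> T" "{p, b} \<in> T" and diag: "{a, b} \<in> T"
  defines "T' \<equiv> (T - {{a, b}, {opposite d a, opposite d b}})
    \<union> {{p, y}, {opposite d p, opposite d y}}"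
  shows "(T, T') \<in> cyclohedron_adjacency d"
proof -
  let ?o = "opposite d"
  let ?e = "{a, b}" and ?f = "{p, y}" and ?S = "{{p, a}, {a, y}, {y, b}, {p, b}}"
  have T'_eq: "T' = (T - {?e, ?o ` ?e}) \<union> {?f, ?o ` ?f}"
    by (simp add: T'_def)
  have lt: "p < 2 * d + 2" "a < 2 * d + 2" "y < 2 * d + 2" "b < 2 * d + 2"
    using edge_less sides by blast+
  have sub: "T \<subseteq> polygon_edges d"
    using cyclohedron_vertices_subset[OF T] .
  have f: "?f \<in> polygon_edges d"
    using lt ord by (simp add: doubleton_in_polygon_edges)
  have o_edge: "?o ` g \<in> polygon_edges d" if "g \<in> polygon_edges d" for g
    using that rotate_edge_in_polygon_edges[of "d + 1"] by (simp add: opposite_eq_rotate)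
  have oo: "?o ` ?o ` g = g" if "g \<in> polygon_edges d" for g
    using that opposite_opposite by (force simp: polygon_edges_def polygon_vertices_def image_image)
  have o_crossing: "crossing (?o ` g) (?o ` h)"
    if "crossing g h" "g \<in> polygon_edges d" "h \<in> polygon_edges d" for g h
    using crossing_rotate[of "d + 1"] that by (simp add: opposite_eq_rotate)
  \<comment> \<open>The sides survive the flip. Each shares an endpoint with \<open>{a, b}\<close>;
    a side equal to the opposite of \<open>{a, b}\<close> would make \<open>a\<close> and
    \<open>b\<close> antipodal and hence be \<open>{a, b}\<close> itself.\<close>
  have S: "s \<in> T" "s \<noteq> ?e" "s \<noteq> ?o ` ?e" if "s \<in> ?S" for s
  proof -
    show "s \<in> T" "s \<noteq> ?e"
      using that sides ord by (auto simp: doubleton_eq_iff)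
    show "s \<noteq> ?o ` ?e"
    proof
      assume s: "s = ?o ` ?e"
      have "?o a \<noteq> a" "?o b \<noteq> b" "?o a = b \<longleftrightarrow> ?o b = a"
        using lt by (auto simp: opposite_if)
      then show False
        using s that \<open>s \<noteq> ?e\<close> by (auto simp: doubleton_eq_iff)
    qed
  qed
  have irrefl: "\<not> crossing g g" if "g \<in> polygon_edges d" for g
    using that by (rule polygon_edge_cases) (simp add: crossing_less)
  have diagonal: "crossing g ?e \<Longrightarrow> g = ?f" "crossing g ?f \<Longrightarrow> g = ?e"
    if g: "g \<in> polygon_edges d" "\<And>s. s \<in> ?S \<Longrightarrow> \<not> crossing g s" for g
  proof -
    obtain u v where uv: "g = {u, v}" "u < v"
      using g(1) by (rule polygon_edge_cases)
    have "\<not> crossing {u, v} {p, a}" "\<not> crossing {u, v} {a, y}"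
      "\<not> crossing {u, v} {y, b}" "\<not> crossing {u, v} {p, b}"
      using g(2) uv(1) by blast+
    from crossing_imp_diagonal[OF ord uv(2) this]
    show "crossing g ?e \<Longrightarrow> g = ?f" "crossing g ?f \<Longrightarrow> g = ?e"
      by (simp_all add: uv(1))
  qed
  have ef: "crossing ?e ?f"
    using ord crossing_less[of a b p y] by linarith
  have only_e: "h = ?e" if h: "h \<in> T" "crossing h ?f" for h
    by (rule diagonal(2)) (use sub S(1) noncrossing h in blast)+
  have only_oe: "h = ?o ` ?e" if "h \<in> T" "crossing h (?o ` ?f)" for h
  proof -
    have "crossing (?o ` h) ?f"
      using o_crossing[OF that(2) subsetD[OF sub that(1)] o_edge[OF f]] oo[OF f] by simp
    then have "?o ` h = ?e"
      using only_e opposite_image_edge that(1) by blast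
    then show ?thesis
      using oo[of h] that(1) sub by auto
  qed
  \<comment> \<open>If the two new edges crossed, the opposite of \<open>{p, y}\<close> would cross
    no side and thus equal \<open>{a, b}\<close>. Then \<open>{p, y}\<close> would lie in
    \<open>T\<close> and cross \<open>{a, b}\<close>.\<close>
  have f_of: "\<not> crossing (?o ` ?f) ?f"
  proof
    assume *: "crossing (?o ` ?f) ?f"
    have "\<not> crossing (?o ` ?f) s" if "s \<in> ?S" for s
      using only_oe[of s] S[OF that] crossing_sym by blast
    then have "?o ` ?f = ?e"
      using diagonal(2)[OF o_edge[OF f]] * by blast
    then have "?f = ?o ` ?e"
      using oo[OF f] by simp
    then show False
      using ef noncrossing[OF diag opposite_image_edge[OF diag]] by simp
  qed
  define e e' f f' where ef_defs: "e = ?e" "e' = ?o ` ?e" "f = ?f" "f' = ?o ` ?f"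
  have T'_iff: "g \<in> T' \<longleftrightarrow> g \<in> T \<and> g \<noteq> e \<and> g \<noteq> e' \<or> g = f \<or> g = f'" for g
    unfolding T'_eq ef_defs Un_iff Diff_iff insert_iff empty_iff by simp
  have e_edges: "e \<in> polygon_edges d" "e' \<in> polygon_edges d" "e \<in> T" "e' \<in> T"
    and f_edges: "f \<in> polygon_edges d" "f' \<in> polygon_edges d"
    using diag opposite_image_edge[OF diag] sub f o_edge[OF f] unfolding ef_defs by blast+
  have o_ef: "?o ` e = e'" "?o ` e' = e" "?o ` f = f'" "?o ` f' = f"
    using oo[OF f] oo[OF subsetD[OF sub diag]] unfolding ef_defs by blast+
  note only_e = only_e[folded ef_defs] and only_oe = only_oe[folded ef_defs]
    and f_of = f_of[folded ef_defs] and ef = ef[folded ef_defs]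
    and diagonal = diagonal(1)[folded ef_defs] and S = S[folded ef_defs]
  have e'f': "crossing e' f'"
    using o_crossing[OF ef e_edges(1) f_edges(1)] o_ef by simp
  have T'_sub: "T' \<subseteq> polygon_edges d"
    using sub f_edges T'_iff by (metis subsetD subsetI)
  have irrefl: "\<not> crossing f f" "\<not> crossing f' f'" "\<not> crossing f f'"
    using irrefl f_edges f_of crossing_sym[of f f'] by (blast, blast, argo)
  have T'_nc: "\<not> crossing g h" if mem: "g \<in> T'" "h \<in> T'" for g h
  proof
    assume gh: "crossing g h"
    note hg = crossing_sym[OF gh]
    have "g \<noteq> f \<and> g \<noteq> f'"
      using mem(2) hg only_e[of h] only_oe[of h] irrefl f_of gh unfolding T'_iff by metis
    moreover have "h \<noteq> f \<and> h \<noteq> f'"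
      using mem(1) hg only_e[of g] only_oe[of g] irrefl f_of gh unfolding T'_iff by metis
    ultimately have "g \<in> T" "h \<in> T"
      using mem unfolding T'_iff by simp_all
    then show False
      using noncrossing gh by simp
  qed
  then have nc: "noncrossing_edges d T'"
    using T'_sub by (simp add: noncrossing_edges_def)
  have o_T': "?o ` g \<in> T'" if mem: "g \<in> T'" for g
  proof (cases "g = f \<or> g = f'")
    case True
    then show ?thesis
      using o_ef unfolding T'_iff by metis
  next
    case False
    then have g: "g \<in> T" "g \<noteq> e" "g \<noteq> e'"
      using mem unfolding T'_iff by simp_all
    then have "?o ` g \<noteq> e" "?o ` g \<noteq> e'"
      using oo[OF subsetD[OF sub g(1)]] o_ef by metis+
    then show ?thesis
      using opposite_image_edge[OF g(1)] unfolding T'_iff by simp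
  qed
  have S': "s \<in> T'" if "s \<in> ?S" for s
    using S[OF that] unfolding T'_iff by simp
  have "g \<in> T'" if g: "g \<in> polygon_edges d" "\<And>h. h \<in> T' \<Longrightarrow> \<not> crossing g h" for g
  proof -
    have og: "?o ` g \<in> polygon_edges d" "?o ` ?o ` g = g"
      using o_edge[OF g(1)] oo[OF g(1)] .
    \<comment> \<open>The claim includes the opposite of \<open>g\<close>, so that a crossing of
      \<open>g\<close> with \<open>e'\<close> can be reduced to one with \<open>e\<close>. Both
      edges avoid the sides because \<open>T'\<close> is centrally symmetric.\<close>
    have crossing_e: "h = f" if h: "h \<in> {g, ?o ` g}" "crossing h e" for h
    proof (rule diagonal[OF _ _ h(2)])
      show "h \<in> polygon_edges d"
        using h(1) g(1) og(1) by (metis insertE singletonD)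
      fix s assume s: "s \<in> ?S"
      have "s \<in> polygon_edges d"
        using S(1)[OF s] sub by (rule subsetD[rotated])
      then have "\<not> crossing (?o ` g) s"
        using o_crossing[OF _ og(1), of s] og(2) g(2)[OF o_T'[OF S'[OF s]]] by metis
      moreover have "\<not> crossing g s"
        using g(2)[OF S'[OF s]] .
      ultimately show "\<not> crossing h s"
        using h(1) by (metis insertE singletonD)
    qed
    consider "crossing g e" | "crossing g e'" | "\<not> crossing g e" "\<not> crossing g e'" by argo
    then show ?thesis
    proof cases
      case 1
      then show ?thesis
        using crossing_e[of g] T'_iff by simp
    next
      case 2
      have "crossing (?o ` g) e"
        using o_crossing[OF 2 g(1) e_edges(2)] o_ef by simp
      then have "?o ` g = f"
        using crossing_e[of "?o ` g"] by simp
      then have "g = f'"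
        using og(2) o_ef(3) by simp
      then show ?thesis
        using T'_iff by simp
    next
      case 3
      have "g \<in> T"
      proof (rule edge_if_noncrossing[OF g(1)])
        fix h assume "h \<in> T"
        then show "\<not> crossing g h"
          using 3 g(2)[of h] unfolding T'_iff by metis
      qed
      moreover have "g \<noteq> e" "g \<noteq> e'"
        using g(2)[of f] g(2)[of f'] ef e'f' unfolding T'_iff by metis+
      ultimately show ?thesis
        unfolding T'_iff by simp
    qed
  qed
  then have "triangulation d T'"
    using nc by (simp add: triangulation_iff)
  then have "T' \<in> cyclohedron_vertices d"
    using o_T' T'_sub by (simp add: cyclohedron_vertices_def centrally_symmetric_iff)
  moreover have "flip d T T'"
  proof -
    have ef: "crossing ?e ?f"
      using ef unfolding ef_defs .
    have "?e \<notin> boundary_edges d"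
    proof
      assume "?e \<in> boundary_edges d"
      then obtain x where x: "x < 2 * d + 2" "?e = {x, (x + 1) mod (2 * d + 2)}"
        by (auto simp: boundary_edges_def polygon_vertices_def)
      show False
      proof (cases "x + 1 < 2 * d + 2")
        case True
        then show False
          using x(2) ord by (auto simp: doubleton_eq_iff)
      next
        case False
        \<comment> \<open>Only the boundary edge that wraps around contains \<open>0\<close>, and
          \<open>p < a < b\<close> excludes it.\<close>
        then have "x + 1 = 2 * d + 2"
          using x(1) by simp
        then have "?e = {x, 0}"
          using x(2) by (simp only: mod_self)
        then show False
          using ord by (auto simp: doubleton_eq_iff)
      qed
    qed
    moreover have "crossing {a, b} {y, p}" "{b, p} \<in> T"
      using ef sides(4) by (simp_all add: insert_commute)
    moreover have "T' = (T - {{a, b}, {?o a, ?o b}}) \<union> {{y, p}, {?o y, ?o p}}"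
      by (simp only: T'_def insert_commute)
    ultimately show ?thesis
      unfolding flip_def using sides(1-3) diag
      by (intro exI[of _ a] exI[of _ b] exI[of _ y] exI[of _ p] conjI DiffI)
  qed
  ultimately show ?thesis
    using T by (simp add: cyclohedron_adjacency_def)
qed

end

section \<open>Fans at the vertex 0\<close>

text \<open>The boundary neighbours \<open>1\<close> and \<open>2 * d + 1\<close> are included, so
  for a vertex of the graph with \<open>d > 0\<close> the cardinality is the number of interior
  edges at \<open>0\<close> plus two.\<close>

definition neighbours :: "nat set set \<Rightarrow> nat set" where
  "neighbours T = {z. {0, z} \<in> T}"

text \<open>For \<open>k\<close> between \<open>1\<close> and \<open>d\<close>, these are the
  vertices other than \<open>0\<close> on the side of the diameter \<open>{k, k + (d + 1)}\<close>
  that contains \<open>0\<close>, its endpoints included.\<close>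

definition arc_around_0 :: "nat \<Rightarrow> nat \<Rightarrow> nat set" where
  "arc_around_0 d k = {1..k} \<union> {d + 1 + k..2 * d + 1}"

text \<open>A fan at \<open>0\<close> consists of the edges from \<open>0\<close> to an arc of length \<open>d + 1\<close> around \<open>0\<close> with
  opposite endpoints \<open>k\<close> and \<open>k + (d + 1)\<close>, of the diameter at \<open>0\<close>, and of the opposite edges.\<close>

definition fan :: "nat \<Rightarrow> nat \<Rightarrow> nat set set \<Rightarrow> bool" where
  "fan d k T \<longleftrightarrow> T \<in> cyclohedron_vertices d \<and> insert (d + 1) (arc_around_0 d k) \<subseteq> neighbours T"

lemma fanI:
  assumes "T \<in> cyclohedron_vertices d"
    and "\<And>z. z \<in> insert (d + 1) (arc_around_0 d k) \<Longrightarrow> {0, z} \<in> T"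
  shows "fan d k T"
  using assms by (auto simp: fan_def neighbours_def)

lemma adjacency_vertices:
  "(T, T') \<in> cyclohedron_adjacency d \<Longrightarrow> T \<in> cyclohedron_vertices d \<and> T' \<in> cyclohedron_vertices d"
  by (simp add: cyclohedron_adjacency_def)

lemma finite_neighbours:
  assumes "T \<in> cyclohedron_vertices d"
  shows "finite (neighbours T)"
  by (rule finite_subset[of _ "{..<2 * d + 2}"])
    (use edge_less[OF assms] in \<open>auto simp: neighbours_def\<close>)

lemma neighbours_bounds:
  assumes "T \<in> cyclohedron_vertices d" "z \<in> neighbours T"
  shows "1 \<le> z" "z \<le> 2 * d + 1"
  using edge_less[OF assms(1), of 0 z] assms(2) by (auto simp: neighbours_def)

lemma boundary_neighbours:
  assumes "T \<in> cyclohedron_vertices d"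
  shows "1 \<in> neighbours T" "2 * d + 1 \<in> neighbours T"
  using boundary_edge(1)[OF assms, of 0] boundary_edge(2)[OF assms] by (simp_all add: neighbours_def)

lemma finite_arc: "finite (arc_around_0 d k)"
  by (simp add: arc_around_0_def)

lemma card_arc: "k \<le> d \<Longrightarrow> card (arc_around_0 d k) = d + 1"
  unfolding arc_around_0_def by (subst card_Un_disjoint) auto

section \<open>Flips that add edges at the vertex 0\<close>

lemma flip_towards_0:
  assumes T: "T \<in> cyclohedron_vertices d"
    and ord: "0 < a" "a < y" "y < b"
    and edges: "{0, a} \<in> T" "{a, y} \<in> T" "{y, b} \<in> T" "{0, b} \<in> T" "{a, b} \<in> T"
    and ne: "a \<noteq> d + 1" "y \<noteq> d + 1" "b \<noteq> d + 1"
  obtains T' where "(T, T') \<in> cyclohedron_adjacency d" "neighbours T' = insert y (neighbours T)"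
    "\<forall>g\<in>T. g \<noteq> {a, b} \<and> g \<noteq> {opposite d a, opposite d b} \<longrightarrow> g \<in> T'"
proof -
  let ?o = "opposite d"
  let ?T' = "(T - {{a, b}, {?o a, ?o b}}) \<union> {{0, y}, {?o 0, ?o y}}"
  have "a < 2 * d + 2" "b < 2 * d + 2" "y < 2 * d + 2"
    using edge_less[OF T] edges by blast+
  \<comment> \<open>As \<open>d + 1\<close> is opposite to \<open>0\<close> and differs from
    \<open>a\<close>, \<open>y\<close> and \<open>b\<close>, the opposite half of the flip neither
    removes nor adds an edge at \<open>0\<close>.\<close>
  then have "?o a \<noteq> 0" "?o b \<noteq> 0" "?o y \<noteq> 0" "?o 0 \<noteq> 0"
    using ne ord by (auto simp: opposite_if)
  then have "{0, z} \<in> ?T' \<longleftrightarrow> {0, z} \<in> T \<or> z = y" for z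
    using ord by (auto simp: doubleton_eq_iff)
  then have "neighbours ?T' = insert y (neighbours T)"
    by (auto simp: neighbours_def)
  then show ?thesis
    using that[OF flip_quadrilateral[OF T ord edges]] by simp
qed

text \<open>The set \<open>B\<close> records what must survive so that the next flip can be chosen
  in the same way: the diameter away from \<open>0\<close>, or the triangle with apex
  \<open>k\<close> on the diameter at \<open>0\<close>.\<close>

lemma grow_fan:
  assumes T: "T \<in> cyclohedron_vertices d" and k: "1 \<le> k" "k \<le> d"
    and B: "B = {{k, k + (d + 1)}} \<or> B = {{0, k}, {k, d + 1}, {0, d + 1}}" "B \<subseteq> T"
    and z: "z \<in> arc_around_0 d k" "z \<notin> neighbours T"
  obtains T' y where "(T, T') \<in> cyclohedron_adjacency d" "B \<subseteq> T'"
    "y \<in> arc_around_0 d k" "y \<notin> neighbours T" "neighbours T' = insert y (neighbours T)"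
proof -
  let ?o = "opposite d"
  have 0: "{0, 1} \<in> T" "{0, 2 * d + 1} \<in> T" "{0, z} \<notin> T"
    using boundary_neighbours[OF T] z(2) by (simp_all add: neighbours_def)
  have z1: "1 < z" "z < 2 * d + 1" "z \<le> k \<or> d + 1 + k \<le> z"
  proof -
    have "z \<noteq> 1" "z \<noteq> 2 * d + 1"
      using 0 by metis+
    then show "1 < z" "z < 2 * d + 1" "z \<le> k \<or> d + 1 + k \<le> z"
      using z(1) k by (auto simp: arc_around_0_def)
  qed
  define Q where "Q a y b \<longleftrightarrow> 0 < a \<and> a < y \<and> y < b \<and> {0, a} \<in> T \<and> {a, y} \<in> T \<and>
    {y, b} \<in> T \<and> {0, b} \<in> T \<and> {a, b} \<in> T \<and> {0, y} \<notin> T" for a y b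
  have "\<exists>a y b. Q a y b \<and> a \<noteq> d + 1 \<and> y \<noteq> d + 1 \<and> b \<noteq> d + 1 \<and> y \<in> arc_around_0 d k \<and>
    (\<forall>g\<in>B. g \<noteq> {a, b} \<and> g \<noteq> {?o a, ?o b})"
    using B(1)
  proof
    assume B1: "B = {{k, k + (d + 1)}}"
    then have diam: "{k, k + (d + 1)} \<in> T"
      using B(2) by simp
    obtain a b y where ab: "1 \<le> a" "a < z" "z < b" "b \<le> 2 * d + 1" "a < y" "y < b"
      and e: "{0, a} \<in> T" "{0, b} \<in> T" "{a, b} \<in> T" "{a, y} \<in> T" "{y, b} \<in> T" "{0, y} \<notin> T"
      using surrounding_neighbours[OF T _ z1(1,2) 0(1,2,3)] by auto
    have nc: "\<not> crossing {u, v} {k, k + (d + 1)}" if "{u, v} \<in> T" for u v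
      using noncrossing[OF T that diam] .
    have kk: "k < k + (d + 1)" "0 < a" "0 < b"
      using ab by simp_all
    have a: "a \<le> k \<or> k + (d + 1) \<le> a" and b: "b \<le> k \<or> k + (d + 1) \<le> b"
      using nc[OF e(1)] nc[OF e(2)] k
      unfolding crossing_less[OF kk(2) kk(1)] crossing_less[OF kk(3) kk(1)] by linarith+
    have y: "\<not> (a < k \<and> k < y \<and> y < k + (d + 1))" "\<not> (k < y \<and> y < k + (d + 1) \<and> k + (d + 1) < b)"
      using nc[OF e(4)] nc[OF e(5)]
      unfolding crossing_less[OF ab(5) kk(1)] crossing_less[OF ab(6) kk(1)] by blast+
    \<comment> \<open>Since \<open>z\<close> lies in the arc and strictly between \<open>a\<close>
      and \<open>b\<close>, the edge \<open>{a, b}\<close> is not the diameter. Non-crossing with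
      the diameter then keeps \<open>y\<close> in the arc.\<close>
    have outer: "a < k \<or> k + (d + 1) < b"
      using z1(3) ab(2,3) by linarith
    then have "y \<le> k \<or> k + (d + 1) \<le> y"
      using y by linarith
    then have "y \<in> arc_around_0 d k" "y \<noteq> d + 1"
      using ab k by (auto simp: arc_around_0_def)
    moreover have "a \<noteq> d + 1" "b \<noteq> d + 1"
      using a b k by linarith+
    moreover have "Q a y b"
      unfolding Q_def using ab e kk by (intro conjI)
    moreover have "{k, k + (d + 1)} \<noteq> {a, b}"
      using outer ab by (auto simp: doubleton_eq_iff)
    moreover have "{k, k + (d + 1)} \<noteq> {?o a, ?o b}"
    proof
      assume "{k, k + (d + 1)} = {?o a, ?o b}"
      then have "?o k = a \<and> ?o (k + (d + 1)) = b \<or> ?o k = b \<and> ?o (k + (d + 1)) = a"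
        using ab opposite_opposite[of a d] opposite_opposite[of b d]
        by (auto simp: doubleton_eq_iff)
      then show False
        using outer ab k by (auto simp: opposite_if)
    qed
    ultimately show ?thesis
      unfolding B1 by (intro exI[of _ a] exI[of _ y] exI[of _ b]) simp
  next
    assume B2: "B = {{0, k}, {k, d + 1}, {0, d + 1}}"
    have tri: "{0, k} \<in> T" "{k, d + 1} \<in> T"
      using B(2) unfolding B2 by simp_all
    have tri': "{0, d + 1 + k} \<in> T"
      using opposite_edge[OF T tri(2)] k by (simp add: opposite_if insert_commute add.commute)
    have "z \<noteq> k" "z \<noteq> d + 1 + k"
      using tri(1) tri' 0(3) by metis+
    then consider "z < k" | "d + 1 + k < z"
      using z1(3) by linarith
    \<comment> \<open>The gap around \<open>z\<close> is sought on one side only, between the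
      neighbours \<open>1\<close> and \<open>k\<close> or between \<open>d + 1 + k\<close> and
      \<open>2 * d + 1\<close>, so that the triangle in \<open>B\<close> stays outside it.\<close>
    then have "\<exists>a y b. Q a y b \<and> (b \<le> k \<or> d + 1 + k \<le> a \<and> b \<le> 2 * d + 1)"
    proof cases
      case 1
      obtain a b y where "1 \<le> a" "a < z" "z < b" "b \<le> k" "a < y" "y < b" "{0, a} \<in> T" "{0, b} \<in> T"
        "{a, b} \<in> T" "{a, y} \<in> T" "{y, b} \<in> T" "{0, y} \<notin> T"
        by (rule surrounding_neighbours[OF T zero_less_one z1(1) 1 0(1) tri(1) 0(3)])
      then show ?thesis
        unfolding Q_def by (intro exI[of _ a] exI[of _ y] exI[of _ b]) simp
    next
      case 2
      obtain a b y where "d + 1 + k \<le> a" "a < z" "z < b" "b \<le> 2 * d + 1" "a < y" "y < b" "{0, a} \<in> T" "{0, b} \<in> T"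
        "{a, b} \<in> T" "{a, y} \<in> T" "{y, b} \<in> T" "{0, y} \<notin> T"
        by (rule surrounding_neighbours[OF T _ 2 z1(2) tri' 0(2) 0(3)]) simp
      then show ?thesis
        unfolding Q_def by (intro exI[of _ a] exI[of _ y] exI[of _ b]) simp
    qed
    then obtain a y b where Q: "Q a y b" and far: "b \<le> k \<or> d + 1 + k \<le> a \<and> b \<le> 2 * d + 1"
      by auto
    then have ab: "0 < a" "a < y" "y < b"
      unfolding Q_def by simp_all
    have ne: "a \<noteq> d + 1" "y \<noteq> d + 1" "b \<noteq> d + 1" "0 < b" "a < 2 * d + 2" "b < 2 * d + 2"
      using ab far k by linarith+
    have "y \<in> arc_around_0 d k"
      using ab far by (auto simp: arc_around_0_def)
    \<comment> \<open>Every edge of \<open>B\<close> contains \<open>0\<close> or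
      \<open>d + 1\<close>, whereas the two flipped edges contain neither.\<close>
    have "?o a \<noteq> 0" "?o b \<noteq> 0" "?o a \<noteq> d + 1" "?o b \<noteq> d + 1"
      using ne ab(1) by (auto simp: opposite_if)
    then have "\<forall>g\<in>B. g \<noteq> {a, b} \<and> g \<noteq> {?o a, ?o b}"
      using ne ab(1) unfolding B2 by (auto simp: doubleton_eq_iff)
    then show ?thesis
      using Q ne(1-3) \<open>y \<in> arc_around_0 d k\<close> by (intro exI[of _ a] exI[of _ y] exI[of _ b]) simp
  qed
  then obtain a y b where "Q a y b"
    and ne: "a \<noteq> d + 1" "y \<noteq> d + 1" "b \<noteq> d + 1" "y \<in> arc_around_0 d k"
    and keep: "\<forall>g\<in>B. g \<noteq> {a, b} \<and> g \<noteq> {?o a, ?o b}"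
    by auto
  then have ord: "0 < a" "a < y" "y < b"
    and e: "{0, a} \<in> T" "{a, y} \<in> T" "{y, b} \<in> T" "{0, b} \<in> T" "{a, b} \<in> T" "{0, y} \<notin> T"
    unfolding Q_def by simp_all
  obtain T' where T': "(T, T') \<in> cyclohedron_adjacency d" "neighbours T' = insert y (neighbours T)"
    "\<forall>g\<in>T. g \<noteq> {a, b} \<and> g \<noteq> {?o a, ?o b} \<longrightarrow> g \<in> T'"
    by (rule flip_towards_0[OF T ord e(1-5) ne(1-3)])
  have "B \<subseteq> T'"
    using T'(3) keep B(2) by (meson subsetD subsetI)
  moreover have "y \<notin> neighbours T"
    using e(6) by (simp add: neighbours_def)
  ultimately show ?thesis
    using that T'(1,2) ne(4) by simp
qed

text \<open>Each use of \<open>grow_fan\<close> lowers the number of missing arc vertices by exactly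
  one, so that number is the length of the walk.\<close>

lemma complete_arc:
  assumes "T \<in> cyclohedron_vertices d" "1 \<le> k" "k \<le> d"
    and "B = {{k, k + (d + 1)}} \<or> B = {{0, k}, {k, d + 1}, {0, d + 1}}" "B \<subseteq> T"
  shows "\<exists>T'. (T, T') \<in> cyclohedron_adjacency d ^^ card (arc_around_0 d k - neighbours T) \<and>
    T' \<in> cyclohedron_vertices d \<and> B \<subseteq> T' \<and> arc_around_0 d k \<subseteq> neighbours T'"
  using assms(1,5)
proof (induction "card (arc_around_0 d k - neighbours T)" arbitrary: T)
  case 0
  then have "arc_around_0 d k \<subseteq> neighbours T"
    using finite_arc by simp
  moreover have "(T, T) \<in> cyclohedron_adjacency d ^^ card (arc_around_0 d k - neighbours T)"
    by (simp add: 0(1)[symmetric])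
  ultimately show ?case
    using 0(2,3) by (intro exI[of _ T] conjI)
next
  case (Suc m)
  have "arc_around_0 d k - neighbours T \<noteq> {}"
  proof
    assume "arc_around_0 d k - neighbours T = {}"
    with Suc.hyps(2) show False
      by (simp only: card.empty)
  qed
  then obtain z where "z \<in> arc_around_0 d k" "z \<notin> neighbours T"
    by auto
  from grow_fan[OF Suc.prems(1) assms(2-4) Suc.prems(2) this]
  obtain T' y where T': "(T, T') \<in> cyclohedron_adjacency d" "B \<subseteq> T'"
    "y \<in> arc_around_0 d k" "y \<notin> neighbours T" "neighbours T' = insert y (neighbours T)" .
  have "arc_around_0 d k - neighbours T' = (arc_around_0 d k - neighbours T) - {y}"
    using T'(5) by auto
  then have m: "m = card (arc_around_0 d k - neighbours T')"
    using Suc.hyps(2) T'(3,4) finite_arc by simp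
  have "\<exists>L. (T', L) \<in> cyclohedron_adjacency d ^^ card (arc_around_0 d k - neighbours T') \<and>
      L \<in> cyclohedron_vertices d \<and> B \<subseteq> L \<and> arc_around_0 d k \<subseteq> neighbours L"
    using Suc.hyps(1)[OF m] adjacency_vertices[OF T'(1)] T'(2) by simp
  then obtain L where L: "(T', L) \<in> cyclohedron_adjacency d ^^ m" "L \<in> cyclohedron_vertices d"
    "B \<subseteq> L" "arc_around_0 d k \<subseteq> neighbours L"
    unfolding m[symmetric] by auto
  have "(T, L) \<in> cyclohedron_adjacency d ^^ card (arc_around_0 d k - neighbours T)"
    using relpow_Suc_I2[OF T'(1) L(1)] Suc.hyps(2) by simp
  then show ?case
    using L(2-4) by (intro exI[of _ L] conjI)
qed

text \<open>Under this condition every flip towards the \<open>k\<close>-fan at \<open>0\<close> can be chosen such that it adds an edge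
  at \<open>0\<close>. If the diameter is not at \<open>0\<close>, it is flipped last.\<close>

definition rooted :: "nat \<Rightarrow> nat \<Rightarrow> nat set set \<Rightarrow> bool" where
  "rooted d k T \<longleftrightarrow> {k, k + (d + 1)} \<in> T \<or> {0, k} \<in> T \<and> {k, d + 1} \<in> T \<and> {0, d + 1} \<in> T"

text \<open>The target \<open>insert (d + 1) (arc_around_0 d k)\<close> has \<open>d + 2\<close>
  elements and contains all neighbours of \<open>0\<close> in \<open>T\<close>. Each flip adds
  exactly one missing element, whence the exponent.\<close>

lemma reach_fan:
  assumes T: "T \<in> cyclohedron_vertices d" and k: "1 \<le> k" "k \<le> d" and "rooted d k T"
  obtains L where "fan d k L" "(T, L) \<in> cyclohedron_adjacency d ^^ (d + 2 - card (neighbours T))"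
proof -
  consider "{k, k + (d + 1)} \<in> T" | "{0, k} \<in> T" "{k, d + 1} \<in> T" "{0, d + 1} \<in> T"
    using assms(4) unfolding rooted_def by argo
  then show ?thesis
  proof cases
    case 1
    \<comment> \<open>Edges at \<open>0\<close> cannot cross the diameter
      \<open>{k, k + (d + 1)}\<close>.\<close>
    have "neighbours T \<subseteq> arc_around_0 d k"
    proof
      fix z assume z: "z \<in> neighbours T"
      have "\<not> crossing {0, z} {k, k + (d + 1)}"
        using noncrossing[OF T _ 1] z by (simp add: neighbours_def)
      then show "z \<in> arc_around_0 d k"
        using neighbours_bounds[OF T z] k crossing_less[of 0 z k "k + (d + 1)"]
        by (auto simp: arc_around_0_def)
    qed
    then have card: "card (arc_around_0 d k - neighbours T) = d + 1 - card (neighbours T)"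
      "card (neighbours T) \<le> d + 1"
      using card_Diff_subset[of "neighbours T"] card_mono[of "arc_around_0 d k" "neighbours T"]
        card_arc[OF k(2)] finite_neighbours[OF T] by (simp_all add: arc_around_0_def)
    obtain L where L: "(T, L) \<in> cyclohedron_adjacency d ^^ card (arc_around_0 d k - neighbours T)"
      "L \<in> cyclohedron_vertices d" "{k, k + (d + 1)} \<in> L" "arc_around_0 d k \<subseteq> neighbours L"
    proof -
      have "{{k, k + (d + 1)}} \<subseteq> T"
        using 1 by simp
      from complete_arc[OF T k disjI1[OF refl] this] show thesis
        using that by auto
    qed
    have e: "{0, k} \<in> L" "{0, k + (d + 1)} \<in> L"
      using subsetD[OF L(4), of k] subsetD[OF L(4), of "k + (d + 1)"] k
      by (simp_all add: arc_around_0_def neighbours_def)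
    have "{k, d + 1} \<in> L" "{d + 1, k + (d + 1)} \<in> L"
      using opposite_edge[OF L(2) e(1)] opposite_edge[OF L(2) e(2)] k
      by (simp_all add: opposite_if insert_commute)
    \<comment> \<open>The quadrilateral with corners \<open>0\<close>, \<open>k\<close>,
      \<open>d + 1\<close>, \<open>k + (d + 1)\<close> is centrally symmetric, so this last flip
      exchanges one diameter for another.\<close>
    then have adj: "(L, (L - {{k, k + (d + 1)}, {opposite d k, opposite d (k + (d + 1))}}) \<union>
      {{0, d + 1}, {opposite d 0, opposite d (d + 1)}}) \<in> cyclohedron_adjacency d" (is "(L, ?L') \<in> _")
      using flip_quadrilateral[OF L(2), of 0 k "d + 1" "k + (d + 1)"] e L(3) k by simp
    have o: "opposite d k = k + (d + 1)" "opposite d (k + (d + 1)) = k"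
      using k by (simp_all add: opposite_if)
    have "{0, z} \<in> ?L'" if "z \<in> insert (d + 1) (arc_around_0 d k)" for z
    proof (cases "z = d + 1")
      case False
      then have "{0, z} \<in> L"
        using that L(4) by (auto simp: neighbours_def)
      moreover have "{0, z} \<noteq> {k, k + (d + 1)}" "{0, z} \<noteq> {k + (d + 1), k}"
        using k by (auto simp: doubleton_eq_iff)
      ultimately show ?thesis
        unfolding o by simp
    qed simp
    then have "fan d k ?L'"
      using adjacency_vertices[OF adj, THEN conjunct2] by (intro fanI)
    moreover have "d + 2 - card (neighbours T) = Suc (card (arc_around_0 d k - neighbours T))"
      using card by simp
    then have "(T, ?L') \<in> cyclohedron_adjacency d ^^ (d + 2 - card (neighbours T))"
      using relpow_Suc_I[OF L(1) adj] by (simp only:)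
    ultimately show ?thesis
      by (rule that)
  next
    case 2
    obtain L where L: "(T, L) \<in> cyclohedron_adjacency d ^^ card (arc_around_0 d k - neighbours T)"
      "L \<in> cyclohedron_vertices d" "{0, d + 1} \<in> L" "arc_around_0 d k \<subseteq> neighbours L"
    proof -
      have "{{0, k}, {k, d + 1}, {0, d + 1}} \<subseteq> T"
        using 2 by simp
      from complete_arc[OF T k disjI2[OF refl] this] show thesis
        using that by auto
    qed
    have e: "{d + 1, k + (d + 1)} \<in> T"
      using opposite_edge[OF T 2(1)] k by (simp add: opposite_if)
    \<comment> \<open>The edge \<open>{k, d + 1}\<close> and its opposite
      \<open>{d + 1, k + (d + 1)}\<close> separate \<open>0\<close> from all vertices outside the
      target set.\<close>
    have sub: "neighbours T \<subseteq> insert (d + 1) (arc_around_0 d k)"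
    proof
      fix z assume z: "z \<in> neighbours T"
      then have "\<not> crossing {0, z} {k, d + 1}" "\<not> crossing {0, z} {d + 1, k + (d + 1)}"
        using noncrossing[OF T _ 2(2)] noncrossing[OF T _ e] by (simp_all add: neighbours_def)
      then show "z \<in> insert (d + 1) (arc_around_0 d k)"
        using neighbours_bounds[OF T z] k crossing_less[of 0 z k "d + 1"]
          crossing_less[of 0 z "d + 1" "k + (d + 1)"] by (auto simp: arc_around_0_def)
    qed
    have "d + 1 \<in> neighbours T" "d + 1 \<notin> arc_around_0 d k"
      using 2 k by (auto simp: neighbours_def arc_around_0_def)
    then have "arc_around_0 d k - neighbours T = insert (d + 1) (arc_around_0 d k) - neighbours T"
      and "card (insert (d + 1) (arc_around_0 d k)) = d + 2"
      using card_arc[OF k(2)] finite_arc by auto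
    then have "card (arc_around_0 d k - neighbours T) = d + 2 - card (neighbours T)"
      using card_Diff_subset[OF finite_neighbours[OF T] sub] by (simp only:)
    moreover have "fan d k L"
      using L by (simp add: fan_def neighbours_def)
    ultimately show ?thesis
      using that L(1) by simp
  qed
qed

section \<open>The path formed by the fans at 0\<close>

lemma fan_edges:
  assumes "fan d k T"
  shows "1 \<le> z \<Longrightarrow> z \<le> k \<Longrightarrow> {0, z} \<in> T" "d + 1 + k \<le> z \<Longrightarrow> z \<le> 2 * d + 1 \<Longrightarrow> {0, z} \<in> T"
    and "{0, d + 1} \<in> T"
    and "k \<le> d \<Longrightarrow> d + 2 \<le> z \<Longrightarrow> z \<le> d + 1 + k \<Longrightarrow> {d + 1, z} \<in> T"
    and "k \<le> z \<Longrightarrow> z \<le> d \<Longrightarrow> {z, d + 1} \<in> T"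
proof -
  have T: "T \<in> cyclohedron_vertices d" and fan: "insert (d + 1) (arc_around_0 d k) \<subseteq> neighbours T"
    using assms by (auto simp: fan_def)
  show *: "1 \<le> z \<Longrightarrow> z \<le> k \<Longrightarrow> {0, z} \<in> T" "d + 1 + k \<le> z \<Longrightarrow> z \<le> 2 * d + 1 \<Longrightarrow> {0, z} \<in> T"
    "{0, d + 1} \<in> T" for z
    using fan by (auto simp: arc_around_0_def neighbours_def)
  show "{d + 1, z} \<in> T" if "k \<le> d" "d + 2 \<le> z" "z \<le> d + 1 + k"
    using opposite_edge[OF T *(1)[of "z - (d + 1)"]] that by (simp add: opposite_if)
  show "{z, d + 1} \<in> T" if "k \<le> z" "z \<le> d"
    using opposite_edge[OF T *(2)[of "z + (d + 1)"]] that by (simp add: opposite_if insert_commute)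
qed

text \<open>The edges listed in \<open>fan_edges\<close> lie in both fans. Any further edge of
  \<open>T\<close> must be a boundary edge, since otherwise it would cross a listed one.\<close>

lemma fan_subset:
  assumes "fan d k T" "fan d k T'" "1 \<le> k" "k \<le> d"
  shows "T \<subseteq> T'"
proof
  fix g assume g: "g \<in> T"
  have T: "T \<in> cyclohedron_vertices d" and T': "T' \<in> cyclohedron_vertices d"
    using assms by (auto simp: fan_def)
  obtain u v where uv: "g = {u, v}" "u < v" "v < 2 * d + 2"
    using subsetD[OF cyclohedron_vertices_subset[OF T] g] by (rule polygon_edge_cases)
  have nc: "\<not> (u < s \<and> s < v \<and> v < t)" "\<not> (s < u \<and> u < t \<and> t < v)" if "{s, t} \<in> T" "s < t" for s t
    using noncrossing[OF T g that(1)] crossing_less[OF uv(2) that(2)] uv(1) by simp_all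
  note F = fan_edges[OF assms(1)] and F' = fan_edges[OF assms(2)]
  consider "u = 0" | "0 < u" "v = d + 1" | "0 < u" "v \<le> d" | "u = d + 1" | "d + 1 < u"
    | "0 < u" "u < d + 1" "d + 1 < v"
    by linarith
  then have "{u, v} \<in> T'"
  proof cases
    case 1
    consider "v \<le> k" | "k < v" "v < d + 1" | "v = d + 1" | "d + 1 < v" "v < d + 1 + k" | "d + 1 + k \<le> v"
      by linarith
    then show ?thesis
    proof cases
      case 2
      then show ?thesis
        using nc(1)[OF F(5)[of k]] assms(3,4) 1 by simp
    next
      case 4
      then show ?thesis
        using nc(1)[OF F(4)[of "d + 1 + k"]] assms(3,4) 1 by simp
    qed (use 1 uv F' in \<open>auto\<close>)
  next
    case 2
    have "{0, k} \<in> T" "0 < k"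
      using F(1)[of k] assms(3) by simp_all
    then have "k \<le> u"
      using nc(2)[of 0 k] 2 assms(4) by simp
    then show ?thesis
      using F'(5)[of u] 2 uv by simp
  next
    case 3
    show ?thesis
    proof (cases "v = Suc u")
      case True
      then show ?thesis
        using boundary_edge(1)[OF T', of u] uv by simp
    next
      case False
      then have "Suc u < v"
        using uv(2) by simp
      then show ?thesis
        \<comment> \<open>The vertex \<open>Suc u\<close> is joined to \<open>0\<close> or to
          \<open>d + 1\<close>, and that edge would cross \<open>{u, v}\<close>.\<close>
        using nc(2)[OF F(1)[of "Suc u"]] nc(1)[OF F(5)[of "Suc u"]] 3 by (cases "Suc u \<le> k") simp_all
    qed
  next
    case 4
    have "{0, d + 1 + k} \<in> T"
      using F(2)[of "d + 1 + k"] assms(4) by simp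
    then have "v \<le> d + 1 + k"
      using nc(2)[of 0 "d + 1 + k"] 4 assms(3) by simp
    then show ?thesis
      using F'(4)[of v] 4 uv assms(4) by simp
  next
    case 5
    show ?thesis
    proof (cases "v = Suc u")
      case True
      then show ?thesis
        using boundary_edge(1)[OF T', of u] uv by simp
    next
      case False
      then have "Suc u < v"
        using uv(2) by simp
      then show ?thesis
        using nc(2)[OF F(4)[of "Suc u"]] nc(2)[OF F(2)[of "Suc u"]] 5 uv assms(4)
        by (cases "Suc u \<le> d + 1 + k") simp_all
    qed
  next
    case 6
    then show ?thesis
      using nc(2)[OF F(3)] by simp
  qed
  then show "g \<in> T'"
    using uv(1) by simp
qed

lemma fan_unique: "fan d k T \<Longrightarrow> fan d k T' \<Longrightarrow> 1 \<le> k \<Longrightarrow> k \<le> d \<Longrightarrow> T = T'"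
  using fan_subset by blast

text \<open>In the quadrilateral \<open>0\<close>, \<open>k\<close>, \<open>k + 1\<close>,
  \<open>d + 1\<close>, flipping \<open>{k, d + 1}\<close> to \<open>{0, k + 1}\<close> moves the
  apex of the triangle on the diameter by one step.\<close>

lemma fan_step:
  assumes "fan d k T" "1 \<le> k" "k < d"
  obtains T' where "(T, T') \<in> cyclohedron_adjacency d" "fan d (k + 1) T'"
proof -
  have T: "T \<in> cyclohedron_vertices d"
    using assms(1) by (simp add: fan_def)
  note F = fan_edges[OF assms(1)]
  let ?T' = "(T - {{k, d + 1}, {opposite d k, opposite d (d + 1)}}) \<union>
    {{0, k + 1}, {opposite d 0, opposite d (k + 1)}}"
  have adj: "(T, ?T') \<in> cyclohedron_adjacency d"
  proof (rule flip_quadrilateral[OF T])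
    show "{k, k + 1} \<in> T"
      using boundary_edge(1)[OF T, of k] assms(3) by simp
  qed (use F(1)[of k] F(5)[of "k + 1"] F(3) F(5)[of k] assms in auto)
  have "{0, z} \<in> ?T'" if "z \<in> insert (d + 1) (arc_around_0 d (k + 1))" for z
  proof (cases "z = k + 1")
    case False
    then have z: "1 \<le> z \<and> z \<le> k \<or> z = d + 1 \<or> d + 2 + k \<le> z \<and> z \<le> 2 * d + 1"
      using that by (auto simp: arc_around_0_def)
    then have "{0, z} \<in> T"
      using F(1)[of z] F(2)[of z] F(3) by auto
    then show ?thesis
      using z assms(2,3) by (auto simp: opposite_if doubleton_eq_iff)
  qed simp
  then have "fan d (k + 1) ?T'"
    using adjacency_vertices[OF adj, THEN conjunct2] by (intro fanI)
  then show ?thesis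
    by (rule that[OF adj])
qed

lemma fan_walk:
  assumes "fan d k T" "fan d (k + m) T'" "1 \<le> k" "k + m \<le> d"
  shows "(T, T') \<in> cyclohedron_adjacency d ^^ m"
  using assms(2,4)
proof (induction m arbitrary: T')
  case 0
  then show ?case
    using fan_unique[OF assms(1)] assms(3) by simp
next
  case (Suc m)
  \<comment> \<open>Iterating \<open>fan_step\<close> shows that the intermediate fan exists; the
    induction hypothesis then supplies the walk to it, and uniqueness of fans identifies its
    successor with \<open>T'\<close>.\<close>
  obtain L where L: "fan d (k + m) L" "(T, L) \<in> cyclohedron_adjacency d ^^ m"
  proof -
    have "\<exists>L. fan d (k + j) L" if "j \<le> m" for j
      using that
    proof (induction j)
      case 0
      then show ?case using assms(1) by auto
    next
      case (Suc j)
      then obtain L where "fan d (k + j) L" by auto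
      then show ?case
        using fan_step[of d "k + j" L] assms(3) Suc.prems \<open>k + Suc m \<le> d\<close> by auto
    qed
    then show ?thesis
      using that Suc.IH Suc.prems(2) by fastforce
  qed
  obtain L' where L': "(L, L') \<in> cyclohedron_adjacency d" "fan d (k + m + 1) L'"
    using fan_step[OF L(1)] assms(3) Suc.prems(2) by auto
  then have "L' = T'"
    using fan_unique[of d "k + Suc m" L' T'] Suc.prems assms(3) by simp
  then show ?case
    using L(2) L'(1) by auto
qed

text \<open>The walk goes from \<open>T\<close> to a fan, along the path of fans, and back out to
  \<open>T'\<close>. With truncated subtraction, \<open>(k - k') + (k' - k)\<close> is the absolute
  difference of the apices.\<close>

lemma walk_via_fans:
  assumes "T \<in> cyclohedron_vertices d" "T' \<in> cyclohedron_vertices d"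
    and "rooted d k T" "rooted d k' T'" "1 \<le> k" "k \<le> d" "1 \<le> k'" "k' \<le> d"
    and "(d + 2 - card (neighbours T)) + (d + 2 - card (neighbours T')) + ((k - k') + (k' - k)) \<le> m"
  shows "\<exists>j\<le>m. (T, T') \<in> cyclohedron_adjacency d ^^ j"
proof -
  obtain L where L: "fan d k L" "(T, L) \<in> cyclohedron_adjacency d ^^ (d + 2 - card (neighbours T))"
    using reach_fan[OF assms(1,5,6,3)] .
  obtain L' where L': "fan d k' L'"
    "(T', L') \<in> cyclohedron_adjacency d ^^ (d + 2 - card (neighbours T'))"
    using reach_fan[OF assms(2,7,8,4)] .
  have "(L, L') \<in> cyclohedron_adjacency d ^^ ((k - k') + (k' - k))"
  proof (cases "k \<le> k'")
    case True
    then show ?thesis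
      using fan_walk[OF L(1), of "k' - k" L'] L'(1) assms(5,8) by simp
  next
    case False
    then show ?thesis
      using fan_walk[OF L'(1), of "k - k'" L] L(1) assms(7,6) adjacency_pow_sym by simp
  qed
  then have "(T, T') \<in> cyclohedron_adjacency d ^^
    ((d + 2 - card (neighbours T)) + ((k - k') + (k' - k)) + (d + 2 - card (neighbours T')))"
    using L(2) adjacency_pow_sym[OF L'(2)] unfolding relpow_add by blast
  then show ?thesis
    using assms(9) by (intro exI conjI[rotated]) (assumption, simp)
qed

section \<open>The diameter bound\<close>

lemma card_neighbours_ge:
  assumes "T \<in> cyclohedron_vertices d" "S \<subseteq> neighbours T"
  shows "card S \<le> card (neighbours T)"
  using card_mono[OF finite_neighbours[OF assms(1)] assms(2)] .

text \<open>Here \<open>k\<close> is the apex of the triangle on the diameter. Besides the two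
  boundary neighbours and \<open>d + 1\<close>, it or its opposite gives a fourth neighbour once
  \<open>d > 1\<close>.\<close>

lemma rooted_if_diameter_0:
  assumes T: "T \<in> cyclohedron_vertices d" and "0 < d" "{0, d + 1} \<in> T"
  obtains k where "1 \<le> k" "k \<le> d" "rooted d k T"
    "d = 1 \<and> 3 \<le> card (neighbours T) \<or> 4 \<le> card (neighbours T)"
proof -
  have "0 + 2 \<le> d + 1"
    using assms(2) by simp
  then obtain k where k: "0 < k" "k < d + 1" "{0, k} \<in> T" "{k, d + 1} \<in> T"
    using triangle_apex[OF T _ assms(3)] by metis
  have k': "{0, k + (d + 1)} \<in> T"
    using opposite_edge[OF T k(4)] k by (simp add: opposite_if insert_commute)
  have sub: "{1, d + 1, 2 * d + 1, k, k + (d + 1)} \<subseteq> neighbours T"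
    using boundary_neighbours[OF T] assms(3) k(3) k' by (simp add: neighbours_def)
  have "d = 1 \<and> 3 \<le> card (neighbours T) \<or> 4 \<le> card (neighbours T)"
  proof -
    consider "d = 1" | "1 < d" "k = 1" | "1 < d" "1 < k"
      using assms(2) k(1) by linarith
    then show ?thesis
    proof cases
      case 1
      then show ?thesis
        using card_neighbours_ge[OF T, of "{1, d + 1, 2 * d + 1}"] sub by simp
    next
      \<comment> \<open>The apex coincides with the boundary neighbour \<open>1\<close>, but its
        opposite \<open>d + 2\<close> differs from \<open>2 * d + 1\<close>.\<close>
      case 2
      then show ?thesis
        using card_neighbours_ge[OF T, of "{1, d + 1, 2 * d + 1, k + (d + 1)}"] sub by simp
    next
      case 3
      then show ?thesis
        using card_neighbours_ge[OF T, of "{1, d + 1, 2 * d + 1, k}"] sub k by simp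
    qed
  qed
  then show ?thesis
    using that[of k] k assms(3) by (simp add: rooted_def)
qed

lemma rotate_edge:
  "{x, y} \<in> T \<Longrightarrow> {rotate_vertex d r x, rotate_vertex d r y} \<in> rotate_edges d r T"
  using imageI[of "{x, y}" T "image (rotate_vertex d r)"] by simp

lemma two_le_card_neighbours:
  assumes "T \<in> cyclohedron_vertices d" "0 < d"
  shows "2 \<le> card (neighbours T)"
  using card_neighbours_ge[OF assms(1), of "{1, 2 * d + 1}"] boundary_neighbours[OF assms(1)] assms(2)
  by simp

text \<open>Two consecutive polygon vertices cannot both be ears.\<close>

lemma neighbours_rotate_1:
  assumes T: "T \<in> cyclohedron_vertices d" and d: "2 \<le> d" and few: "card (neighbours T) < 3"
  shows "3 \<le> card (neighbours (rotate_edges d 1 T))"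
proof -
  have b: "{1, 2 * d + 1} \<subseteq> neighbours T"
    using boundary_neighbours[OF T] by simp
  have "{1, 2 * d + 1} \<in> T"
  proof (rule consecutive_neighbours_edge[OF T, of 0])
    fix c assume c: "1 < c" "c < 2 * d + 1"
    show "{0, c} \<notin> T"
    proof
      assume "{0, c} \<in> T"
      then have "{1, c, 2 * d + 1} \<subseteq> neighbours T"
        using b by (simp add: neighbours_def)
      from card_neighbours_ge[OF T this] show False
        using c few by simp
    qed
  qed (use b d in \<open>simp_all add: neighbours_def\<close>)
  \<comment> \<open>Rotation by one step brings the vertex \<open>2 * d + 1\<close> to
    \<open>0\<close> and turns the edge that cuts off the ear into \<open>{2, 0}\<close>.\<close>
  from rotate_edge[OF this, of d 1] have "2 \<in> neighbours (rotate_edges d 1 T)"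
    using d by (simp add: rotate_vertex_if neighbours_def insert_commute numeral_2_eq_2)
  moreover have T1: "rotate_edges d 1 T \<in> cyclohedron_vertices d"
    by (rule rotate_cyclohedron_vertices[OF _ T]) simp
  ultimately have "{1, 2, 2 * d + 1} \<subseteq> neighbours (rotate_edges d 1 T)"
    using boundary_neighbours[OF T1] by simp
  from card_neighbours_ge[OF T1 this] show ?thesis
    using d by simp
qed

text \<open>The largest offset, together with \<open>d = 1\<close>, is treated by fans at
  \<open>0\<close>, which is an endpoint of the diameter of \<open>T\<close>. Smaller offsets use
  fans at a vertex away from both diameters.\<close>

lemma short_walk_normalized:
  assumes T: "T \<in> cyclohedron_vertices d" and T': "T' \<in> cyclohedron_vertices d" and d: "0 < d"
    and diam: "{0, d + 1} \<in> T" "{p, p + (d + 1)} \<in> T'" and p: "2 * p \<le> d + 1"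
  shows "\<exists>j\<le>2 * d + (d + 1) div 2 - 2. (T, T') \<in> cyclohedron_adjacency d ^^ j"
proof (cases "d = 1 \<or> (d + 1) div 2 \<le> p")
  case True
  obtain k where k: "1 \<le> k" "k \<le> d" "rooted d k T"
    "d = 1 \<and> 3 \<le> card (neighbours T) \<or> 4 \<le> card (neighbours T)"
    by (rule rooted_if_diameter_0[OF T d diam(1)])
  show ?thesis
  proof (cases "p = 0")
    case True
    \<comment> \<open>The other alternative of this case fails for \<open>p = 0\<close>, as
      \<open>(d + 1) div 2\<close> is positive.\<close>
    then have "d = 1"
      using \<open>d = 1 \<or> _\<close> d by auto
    obtain k' where k': "1 \<le> k'" "k' \<le> d" "rooted d k' T'"
      "d = 1 \<and> 3 \<le> card (neighbours T') \<or> 4 \<le> card (neighbours T')"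
      using rooted_if_diameter_0[OF T' d] diam(2) True by auto
    show ?thesis
      by (rule walk_via_fans[OF T T' k(3) k'(3)]) (use k k' \<open>d = 1\<close> in auto)
  next
    case False
    have "rooted d p T'"
      using diam(2) by (simp add: rooted_def)
    then show ?thesis
    proof (rule walk_via_fans[OF T T' k(3)])
      \<comment> \<open>Here \<open>p = (d + 1) div 2\<close> lies in the middle of the range from
        \<open>1\<close> to \<open>d\<close>, so no apex \<open>k\<close> is farther away than
        that.\<close>
      have "k - p + (p - k) \<le> (d + 1) div 2 \<and> (d = 1 \<longrightarrow> k = p)"
        using k(1,2) p False True d by auto
      then show "(d + 2 - card (neighbours T)) + (d + 2 - card (neighbours T')) + ((k - p) + (p - k))
          \<le> 2 * d + (d + 1) div 2 - 2"
        using k(4) two_le_card_neighbours[OF T' d] d by auto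
    qed (use False p k in auto)
  qed
next
  case False
  then have d2: "2 \<le> d" and p2: "p + 2 \<le> d" "p + 1 \<le> (d + 1) div 2"
    using d by auto
  \<comment> \<open>One step plus half a turn: the diameters move to \<open>1\<close> and
    \<open>p + 1\<close>, so \<open>0\<close> lies just outside the arc between them. One further
    step gives \<open>2\<close> and \<open>p + 2\<close>, where \<open>p + 2 \<le> d\<close> keeps
    \<open>0\<close> off both diameters.\<close>
  let ?r = "d + 2"
  let ?U = "rotate_edges d ?r T" and ?U' = "rotate_edges d ?r T'"
  have r: "?r \<le> 2 * d + 2" "(1::nat) \<le> 2 * d + 2"
    using d by simp_all
  have U: "?U \<in> cyclohedron_vertices d" "?U' \<in> cyclohedron_vertices d"
    using rotate_cyclohedron_vertices[OF r(1)] T T' by blast+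
  let ?V = "rotate_edges d 1 ?U" and ?V' = "rotate_edges d 1 ?U'"
  have V: "?V \<in> cyclohedron_vertices d" "?V' \<in> cyclohedron_vertices d"
    using rotate_cyclohedron_vertices[OF r(2)] U by blast+
  have Ud: "{1, 1 + (d + 1)} \<in> ?U" "{p + 1, p + 1 + (d + 1)} \<in> ?U'"
    using rotate_edge[OF diam(1), of d ?r] rotate_edge[OF diam(2), of d ?r] d2 p2
    by (simp_all add: rotate_vertex_if insert_commute add_2_eq_Suc')
  then have Vd: "{2, 2 + (d + 1)} \<in> ?V" "{p + 2, p + 2 + (d + 1)} \<in> ?V'"
    using rotate_edge[OF Ud(1), of d 1] rotate_edge[OF Ud(2), of d 1] d2 p2
    by (simp_all add: rotate_vertex_if eval_nat_numeral)
  have "\<exists>j\<le>2 * d + (d + 1) div 2 - 2. (?U, ?U') \<in> cyclohedron_adjacency d ^^ j"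
  proof (cases "3 \<le> card (neighbours ?U)")
    case True
    show ?thesis
    proof (rule walk_via_fans[OF U])
      show "rooted d 1 ?U" "rooted d (p + 1) ?U'"
        using Ud by (simp_all add: rooted_def)
    qed (use True two_le_card_neighbours[OF U(2) d] d2 p2 in auto)
  next
    case False
    \<comment> \<open>If the first candidate vertex is an ear of the triangulation, the adjacent one
      is not.\<close>
    then have "3 \<le> card (neighbours ?V)"
      using neighbours_rotate_1[OF U(1) d2] by simp
    have "\<exists>j\<le>2 * d + (d + 1) div 2 - 2. (?V, ?V') \<in> cyclohedron_adjacency d ^^ j"
    proof (rule walk_via_fans[OF V])
      show "rooted d 2 ?V" "rooted d (p + 2) ?V'"
        using Vd by (simp_all add: rooted_def)
    qed (use \<open>3 \<le> card (neighbours ?V)\<close> two_le_card_neighbours[OF V(2) d] d2 p2 in auto)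
    then show ?thesis
      using rotate_adjacency_pow_iff[OF r(2) U] by simp
  qed
  then show ?thesis
    using rotate_adjacency_pow_iff[OF r(1) T T'] by simp
qed

text \<open>Of the two offsets \<open>c' - c\<close> and \<open>d + 1 - (c' - c)\<close>, one is at
  most half of \<open>d + 1\<close>. Rotating the appropriate diameter to \<open>0\<close> reduces
  to the normalized situation.\<close>

lemma short_walk_ordered:
  assumes T: "T \<in> cyclohedron_vertices d" and T': "T' \<in> cyclohedron_vertices d" and d: "0 < d"
    and diam: "{c, c + (d + 1)} \<in> T" "{c', c' + (d + 1)} \<in> T'" and c: "c \<le> c'" "c' \<le> d"
  shows "\<exists>j\<le>2 * d + (d + 1) div 2 - 2. (T, T') \<in> cyclohedron_adjacency d ^^ j"
proof (cases "2 * (c' - c) \<le> d + 1")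
  case True
  have r: "2 * d + 2 - c \<le> 2 * d + 2"
    by simp
  have rot: "rotate_vertex d (2 * d + 2 - c) x = x - c" if "c \<le> x" "x < 2 * d + 2" for x
  proof -
    have "x + (2 * d + 2 - c) = (x - c) + (2 * d + 2)"
      using that c by simp
    then show ?thesis
      using that unfolding rotate_vertex_def by (metis mod_add_self2 mod_less less_imp_diff_less)
  qed
  let ?U = "rotate_edges d (2 * d + 2 - c) T" and ?U' = "rotate_edges d (2 * d + 2 - c) T'"
  have "{0, d + 1} \<in> ?U" "{c' - c, c' - c + (d + 1)} \<in> ?U'"
    using rotate_edge[OF diam(1), of d "2 * d + 2 - c"] rotate_edge[OF diam(2), of d "2 * d + 2 - c"] c
    by (simp_all add: rot Suc_diff_le)
  then have "\<exists>j\<le>2 * d + (d + 1) div 2 - 2. (?U, ?U') \<in> cyclohedron_adjacency d ^^ j"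
    using rotate_cyclohedron_vertices[OF r] T T' d True by (intro short_walk_normalized) simp_all
  then show ?thesis
    using rotate_adjacency_pow_iff[OF r T T'] by simp
next
  case False
  have r: "2 * d + 2 - c' \<le> 2 * d + 2"
    by simp
  have rot: "rotate_vertex d (2 * d + 2 - c') x =
    (if c' \<le> x then x - c' else x + (2 * d + 2 - c'))" if "x < 2 * d + 2" for x
  proof (cases "c' \<le> x")
    case True
    then have "x + (2 * d + 2 - c') = (x - c') + (2 * d + 2)"
      using c by simp
    then show ?thesis
      using that True unfolding rotate_vertex_def by (metis mod_add_self2 mod_less less_imp_diff_less)
  next
    case False
    then show ?thesis
      using c by (simp add: rotate_vertex_def)
  qed
  let ?U = "rotate_edges d (2 * d + 2 - c') T" and ?U' = "rotate_edges d (2 * d + 2 - c') T'"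
  \<comment> \<open>The complementary offset: now the diameter of \<open>T'\<close> goes to
    \<open>0\<close>, the two triangulations exchange roles, and the endpoint
    \<open>c + (d + 1)\<close> of the other diameter lands on \<open>?p\<close>.\<close>
  let ?p = "c + (d + 1) - c'"
  have "{0, d + 1} \<in> ?U'"
    using rotate_edge[OF diam(2), of d "2 * d + 2 - c'"] c by (simp add: rot)
  moreover have "rotate_vertex d (2 * d + 2 - c') c = ?p + (d + 1)"
    "rotate_vertex d (2 * d + 2 - c') (c + (d + 1)) = ?p"
    using rot[of c] rot[of "c + (d + 1)"] c False by auto
  then have "{?p, ?p + (d + 1)} \<in> ?U"
    using rotate_edge[OF diam(1), of d "2 * d + 2 - c'"] by (simp add: insert_commute)
  ultimately have "\<exists>j\<le>2 * d + (d + 1) div 2 - 2. (?U', ?U) \<in> cyclohedron_adjacency d ^^ j"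
    using rotate_cyclohedron_vertices[OF r] T T' d False
    by (intro short_walk_normalized[of _ d _ ?p]) simp_all
  then show ?thesis
    using rotate_adjacency_pow_iff[OF r T' T] adjacency_pow_sym by auto
qed

lemma short_walk:
  assumes "T \<in> cyclohedron_vertices d" "T' \<in> cyclohedron_vertices d" "0 < d"
  shows "\<exists>j\<le>2 * d + (d + 1) div 2 - 2. (T, T') \<in> cyclohedron_adjacency d ^^ j"
proof -
  obtain c where c: "c \<le> d" "{c, c + (d + 1)} \<in> T"
    by (rule diameter_edge[OF assms(1)])
  obtain c' where c': "c' \<le> d" "{c', c' + (d + 1)} \<in> T'"
    by (rule diameter_edge[OF assms(2)])
  show ?thesis
  proof (cases "c \<le> c'")
    case True
    then show ?thesis
      using short_walk_ordered[OF assms c(2) c'(2)] c'(1) by simp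
  next
    case False
    then show ?thesis
      using short_walk_ordered[OF assms(2,1,3) c'(2) c(2)] c(1) adjacency_pow_sym by fastforce
  qed
qed

theorem corollary1:
  fixes d :: nat
  assumes "d > 0"
  shows "cyclohedron_diameter d \<le> enat (nat (\<lceil>5 * real d / 2\<rceil> - 2))"
proof -
  \<comment> \<open>In natural arithmetic, \<open>(d + 1) div 2\<close> is the ceiling of
    \<open>d / 2\<close>.\<close>
  have "\<lceil>5 * real d / 2\<rceil> = int (2 * d + (d + 1) div 2)"
    by (rule ceiling_unique) (cases "even d"; auto elim!: evenE oddE)+
  then have bound: "nat (\<lceil>5 * real d / 2\<rceil> - 2) = 2 * d + (d + 1) div 2 - 2"
    by simp
  have "graph_distance (cyclohedron_adjacency d) T T' \<le> enat (2 * d + (d + 1) div 2 - 2)"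
    if TT': "T \<in> cyclohedron_vertices d" "T' \<in> cyclohedron_vertices d" for T T'
  proof -
    obtain j where "j \<le> 2 * d + (d + 1) div 2 - 2" "(T, T') \<in> cyclohedron_adjacency d ^^ j"
      using short_walk[OF TT' assms] by blast
    then show ?thesis
      unfolding graph_distance_def by (intro INF_lower2[of j]) simp_all
  qed
  then show ?thesis
    unfolding cyclohedron_diameter_def graph_diameter_def bound by (intro SUP_least)
qed

end
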